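(* Let $1\le p<\infty$ with conjugate exponent $p'$, and let $n,m\in\mathbb N$. Suppose that $X$ is a finite-dimensional real Banach space and $C_{p,X}(n,m)<\infty$. Then the solution fibres $\mathcal H(g)$, $g\in L_{p'}(G_{m,n}\times[n];X^* )$, admit an odd positively homogeneous selection of minimal-norm representatives, i.e. an odd positively homogeneous map $\Phi$ such that for every $g$ one has $\Phi(g)\in\mathcal H(g)$ and $\|\Phi(g)\|=\min_{h\in\mathcal H(g)}\|h\|$ (norms in $L_{p'}(G_{m,n}\times\Sigma_n;X^* )$). For every $\varepsilon>0$, the fibres also admit a continuous odd positively homogeneous selection $\Phi_\varepsilon$ satisfying, for every $g$, $$\|\Phi_\varepsilon(g)\|_{L_{p'}(G_{m,n}\times\Sigma_n;X^* )}\le(1+\varepsilon)\,C_{p,X}(n,m)\,\|g\|_{L_{p'}(G_{m,n}\times[n];X^* )}.$$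
   Context: All Banach spaces are real; $\mathbb N=\{1,2,\ldots\}$; $[n]=\{1,\ldots,n\}$; $p'=\infty$ when $p=1$; $X^*$ is the Banach dual of $X$. Let $G_{m,n}=(\mathbb Z/(2m\mathbb Z))^n$ and $\Sigma_n=\{-1,1\}^n$. Let $e_j$ be the $j$-th standard basis vector; additions in $G_{m,n}$ are modulo $2m$. For a finite nonempty set $\Omega$, a Banach space $Y$ and $1\le r<\infty$, $L_r(\Omega;Y)$ is the space of all maps $F:\Omega\to Y$ with $\|F\|_{L_r(\Omega;Y)}=\bigl(|\Omega|^{-1}\sum_{\omega\in\Omega}\|F(\omega)\|_Y^r\bigr)^{1/r}$; for $r=\infty$ the norm is the maximum of $\|F(\omega)\|_Y$. For $F:G_{m,n}\to X$ define $(D_{\mathrm{long}}F)(x,j)=F(x+me_j)-F(x)$ for $(x,j)\in G_{m,n}\times[n]$ and $(D_{\mathrm{sgn}}F)(x,\varepsilon)=F(x+\varepsilon)-F(x)$ for $(x,\varepsilon)\in G_{m,n}\times\Sigma_n$. Define $$C_{p,X}(n,m)=\sup_{F:\,D_{\mathrm{sgn}}F\ne0}\frac{\|D_{\mathrm{long}}F\|_{L_p(G_{m,n}\times[n];X)}}{\|D_{\mathrm{sgn}}F\|_{L_p(G_{m,n}\times\Sigma_n;X)}},$$ with $C_{p,X}(n,m)=+\infty$ when $\ker D_{\mathrm{sgn}}\not\subseteq\ker D_{\mathrm{long}}$, and an empty supremum equal to $0$. For $g:G_{m,n}\times[n]\to X^*$ and $h:G_{m,n}\times\Sigma_n\to X^*$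 define $$D_{\mathrm{long}}^*g(x)=\frac1n\sum_{j=1}^n\bigl(g(x-me_j,j)-g(x,j)\bigr),\qquad D_{\mathrm{sgn}}^*h(x)=2^{-n}\sum_{\varepsilon\in\Sigma_n}\bigl(h(x-\varepsilon,\varepsilon)-h(x,\varepsilon)\bigr).$$ The solution fibre of $g$ is $\mathcal H(g)=\{h\in L_{p'}(G_{m,n}\times\Sigma_n;X^* ):D_{\mathrm{sgn}}^*h=D_{\mathrm{long}}^*g\}$. A selection of the fibres is a map $\Phi:L_{p'}(G_{m,n}\times[n];X^* )\to L_{p'}(G_{m,n}\times\Sigma_n;X^* )$ with $\Phi(g)\in\mathcal H(g)$ for every $g$. It is odd if $\Phi(-g)=-\Phi(g)$ for all $g$, and positively homogeneous if $\Phi(tg)=t\Phi(g)$ for all $g$ and all $t\ge0$. *)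

theory Defs
  imports "HOL-Analysis.Analysis"
begin

section \<open>The spaces \<open>L\<^sub>r(\<Omega>; Y)\<close> over a finite set\<close>

text \<open>Maps \<open>\<Omega> \<rightarrow> Y\<close> are represented by total functions that vanish outside \<open>\<Omega>\<close>. In this way
  pointwise operations of total functions are the vector space operations, and equality
  of functions is equality on \<open>\<Omega>\<close>.\<close>

definition maps :: "'w set \<Rightarrow> ('w \<Rightarrow> 'b::real_normed_vector) set" where
  "maps \<Omega> = {F. \<forall>w. w \<notin> \<Omega> \<longrightarrow> F w = 0}"

definition Lnorm :: "ereal \<Rightarrow> 'w set \<Rightarrow> ('w \<Rightarrow> 'b::real_normed_vector) \<Rightarrow> real" where
  "Lnorm r \<Omega> F =
     (if r = \<infinity> then Max ((\<lambda>w. norm (F w)) ` \<Omega>)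
      else ((\<Sum>w\<in>\<Omega>. norm (F w) powr real_of_ereal r) / real (card \<Omega>)) powr (1 / real_of_ereal r))"

definition Ldist :: "ereal \<Rightarrow> 'w set \<Rightarrow> ('w \<Rightarrow> 'b::real_normed_vector) \<Rightarrow> ('w \<Rightarrow> 'b) \<Rightarrow> real" where
  "Ldist r \<Omega> F H = Lnorm r \<Omega> (\<lambda>w. F w - H w)"

text \<open>The norm topology of \<open>L\<^sub>r(\<Omega>; Y)\<close>; \<open>Metric_space_Ldist\<close> below shows that
  \<open>Ldist\<close> is a metric, so that \<open>mtopology\<close> has its intended meaning.\<close>

definition Ltopology :: "ereal \<Rightarrow> 'w set \<Rightarrow> ('w \<Rightarrow> 'b::real_normed_vector) topology" where
  "Ltopology r \<Omega> = Metric_space.mtopology (maps \<Omega>) (Ldist r \<Omega>)"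

definition conj_exponent :: "real \<Rightarrow> ereal" where
  "conj_exponent p = (if p = 1 then \<infinity> else ereal (p / (p - 1)))"

lemma powr_convex_nonneg:
  fixes u v t r :: real
  assumes "0 \<le> u" "0 \<le> v" "0 \<le> t" "t \<le> 1" "1 \<le> r"
  shows "(t * u + (1 - t) * v) powr r \<le> t * u powr r + (1 - t) * v powr r"
proof -
  have le: "s powr r \<le> s" if "0 \<le> s" "s \<le> 1" for s :: real
    using powr_mono'[OF assms(5) that] that by (simp add: powr_one_gt_zero_iff)
  show ?thesis
  proof (cases "u = 0 \<or> v = 0")
    case True
    then show ?thesis
      using le[of t] le[of "1 - t"] assms by (auto simp: powr_mult intro!: mult_right_mono)
  next
    case False
    then show ?thesis
      using convex_onD[OF powr_convex[OF assms(5)], of "1 - t" u v] assms by (simp add: algebra_simps)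
  qed
qed

lemma Lnorm_nonneg: "finite \<Omega> \<Longrightarrow> \<Omega> \<noteq> {} \<Longrightarrow> 0 \<le> Lnorm r \<Omega> F"
  by (auto simp: Lnorm_def Max_ge_iff)

lemma Lnorm_powr:
  assumes "1 \<le> r" "finite \<Omega>" "\<Omega> \<noteq> {}"
  shows "Lnorm (ereal r) \<Omega> F powr r = (\<Sum>w\<in>\<Omega>. norm (F w) powr r) / real (card \<Omega>)"
  using assms by (simp add: Lnorm_def powr_powr sum_nonneg)

lemma Lnorm_eq_0_iff:
  assumes "1 \<le> r" "finite \<Omega>" "\<Omega> \<noteq> {}"
  shows "Lnorm r \<Omega> F = 0 \<longleftrightarrow> (\<forall>w\<in>\<Omega>. F w = 0)"
proof (cases r)
  case (real s)
  then have "Lnorm r \<Omega> F = 0 \<longleftrightarrow> (\<Sum>w\<in>\<Omega>. norm (F w) powr s) = 0"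
    using assms by (simp add: Lnorm_def)
  also have "\<dots> \<longleftrightarrow> (\<forall>w\<in>\<Omega>. F w = 0)"
    using assms by (subst sum_nonneg_eq_0_iff) auto
  finally show ?thesis .
next
  case PInf
  then have "Lnorm r \<Omega> F \<le> 0 \<longleftrightarrow> (\<forall>w\<in>\<Omega>. F w = 0)" using assms by (simp add: Lnorm_def)
  then show ?thesis
    using Lnorm_nonneg[OF assms(2,3), of r F] by linarith
next
  case MInf
  then show ?thesis using assms by simp
qed

lemma Lnorm_triangle:
  fixes F H :: "'w \<Rightarrow> 'b::real_normed_vector"
  assumes "1 \<le> r" "finite \<Omega>" "\<Omega> \<noteq> {}"
  shows "Lnorm r \<Omega> (\<lambda>w. F w + H w) \<le> Lnorm r \<Omega> F + Lnorm r \<Omega> H"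
proof (cases r)
  case (real s)
  with assms have s: "1 \<le> s" by simp
  define a b where "a = Lnorm r \<Omega> F" and "b = Lnorm r \<Omega> H"
  have ab: "0 \<le> a" "0 \<le> b" using Lnorm_nonneg assms by (auto simp: a_def b_def)
  show ?thesis
  proof (cases "a = 0 \<or> b = 0")
    case True
    then consider "\<forall>w\<in>\<Omega>. F w = 0" | "\<forall>w\<in>\<Omega>. H w = 0"
      using Lnorm_eq_0_iff[OF assms] by (auto simp: a_def b_def)
    then show ?thesis
    proof cases
      case 1
      then have "Lnorm r \<Omega> (\<lambda>w. F w + H w) = Lnorm r \<Omega> H" using real by (simp add: Lnorm_def)
      then show ?thesis using ab by (simp add: a_def)
    next
      case 2
      then have "Lnorm r \<Omega> (\<lambda>w. F w + H w) = Lnorm r \<Omega> F" using real by (simp add: Lnorm_def)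
      then show ?thesis using ab by (simp add: b_def)
    qed
  next
    case False
    with ab have ab': "0 < a" "0 < b" by auto
    define t where "t = a / (a + b)"
    have t: "0 \<le> t" "t \<le> 1" "1 - t = b / (a + b)" using ab' by (auto simp: t_def field_simps)
    have A: "(\<Sum>w\<in>\<Omega>. norm (F w) powr s) = a powr s * real (card \<Omega>)"
      and B: "(\<Sum>w\<in>\<Omega>. norm (H w) powr s) = b powr s * real (card \<Omega>)"
      using assms(2,3) by (simp_all add: a_def b_def real Lnorm_powr[OF s assms(2,3)])
    have pt: "norm (F w + H w) powr s \<le>
        (a + b) powr s * (t * (norm (F w) powr s / a powr s) + (1 - t) * (norm (H w) powr s / b powr s))" for w
    proof -
      have "norm (F w + H w) powr s \<le> (norm (F w) + norm (H w)) powr s"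
        using s by (intro powr_mono2 norm_triangle_ineq) auto
      also have "norm (F w) + norm (H w) = (a + b) * (t * (norm (F w) / a) + (1 - t) * (norm (H w) / b))"
      proof -
        have "(a + b) * t = a" "(a + b) * (1 - t) = b"
          using ab' unfolding t(3) by (simp_all add: t_def)
        then show ?thesis using ab' by (simp add: distrib_left mult.assoc[symmetric])
      qed
      also have "\<dots> powr s = (a + b) powr s * (t * (norm (F w) / a) + (1 - t) * (norm (H w) / b)) powr s"
        using ab' t by (intro powr_mult) 
      also have "\<dots> \<le> (a + b) powr s * (t * (norm (F w) / a) powr s + (1 - t) * (norm (H w) / b) powr s)"
        using ab' t s by (intro mult_left_mono powr_convex_nonneg) auto
      finally show ?thesis using ab' by (simp add: powr_divide)
    qed
    have "(\<Sum>w\<in>\<Omega>. norm (F w + H w) powr s) \<le>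
      (\<Sum>w\<in>\<Omega>. (a + b) powr s * (t * (norm (F w) powr s / a powr s) + (1 - t) * (norm (H w) powr s / b powr s)))"
      by (intro sum_mono pt)
    also have "\<dots> = (a + b) powr s * (t * ((\<Sum>w\<in>\<Omega>. norm (F w) powr s) / a powr s)
        + (1 - t) * ((\<Sum>w\<in>\<Omega>. norm (H w) powr s) / b powr s))"
      by (simp add: sum.distrib sum_distrib_left[symmetric] sum_divide_distrib[symmetric])
    also have "\<dots> = (a + b) powr s * real (card \<Omega>)"
      unfolding A B using ab' by (simp add: algebra_simps)
    finally have "(\<Sum>w\<in>\<Omega>. norm (F w + H w) powr s) / real (card \<Omega>) \<le> (a + b) powr s"
      using assms by (simp add: divide_le_eq card_gt_0_iff)
    then have "((\<Sum>w\<in>\<Omega>. norm (F w + H w) powr s) / real (card \<Omega>)) powr (1 / s) \<le> ((a + b) powr s) powr (1 / s)"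
      using s by (intro powr_mono2) (auto intro!: divide_nonneg_nonneg sum_nonneg)
    also have "\<dots> = a + b" using s ab' by (simp add: powr_powr)
    finally show ?thesis using real by (simp add: Lnorm_def a_def b_def)
  qed
next
  case PInf
  have "norm (F w + H w) \<le> Max ((\<lambda>w. norm (F w)) ` \<Omega>) + Max ((\<lambda>w. norm (H w)) ` \<Omega>)" if "w \<in> \<Omega>" for w
    using that assms by (intro order_trans[OF norm_triangle_ineq] add_mono Max_ge) auto
  then show ?thesis using PInf assms by (auto simp: Lnorm_def Max_le_iff)
next
  case MInf
  then show ?thesis using assms by simp
qed

lemma Metric_space_Ldist:
  assumes "1 \<le> r" "finite \<Omega>" "\<Omega> \<noteq> {}"
  shows "Metric_space (maps \<Omega> :: ('w \<Rightarrow> 'b::real_normed_vector) set) (Ldist r \<Omega>)"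
proof
  fix F H K :: "'w \<Rightarrow> 'b"
  show "0 \<le> Ldist r \<Omega> F H" using Lnorm_nonneg assms by (auto simp: Ldist_def)
  show "Ldist r \<Omega> F H = Ldist r \<Omega> H F" by (simp add: Ldist_def Lnorm_def norm_minus_commute)
  show "Ldist r \<Omega> F H = 0 \<longleftrightarrow> F = H" if "F \<in> maps \<Omega>" "H \<in> maps \<Omega>"
    using that by (force simp: Ldist_def Lnorm_eq_0_iff[OF assms] maps_def fun_eq_iff)
  show "Ldist r \<Omega> F K \<le> Ldist r \<Omega> F H + Ldist r \<Omega> H K"
    using Lnorm_triangle[OF assms, of "\<lambda>w. F w - H w" "\<lambda>w. H w - K w"] by (simp add: Ldist_def)
qed


section \<open>The group \<open>(\<int>/2m\<int>)\<^sup>n\<close> and the difference operators\<close>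

text \<open>Elements of \<open>\<int>/2m\<int>\<close> are represented by their residues in \<open>{0..<2m}\<close>, and
  coordinates are indexed by \<open>{1..n}\<close>.\<close>

definition G :: "nat \<Rightarrow> nat \<Rightarrow> (nat \<Rightarrow> int) set" where
  "G m n = {1..n} \<rightarrow>\<^sub>E {0..<2 * int m}"

definition signs :: "nat \<Rightarrow> (nat \<Rightarrow> int) set" where
  "signs n = {1..n} \<rightarrow>\<^sub>E {-1, 1}"

definition translate :: "nat \<Rightarrow> nat \<Rightarrow> (nat \<Rightarrow> int) \<Rightarrow> (nat \<Rightarrow> int) \<Rightarrow> (nat \<Rightarrow> int)" where
  "translate m n x v = (\<lambda>i\<in>{1..n}. (x i + v i) mod (2 * int m))"

definition basis_vec :: "nat \<Rightarrow> nat \<Rightarrow> int" where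
  "basis_vec j = (\<lambda>i. if i = j then 1 else 0)"

definition D_long :: "nat \<Rightarrow> nat \<Rightarrow> ((nat \<Rightarrow> int) \<Rightarrow> 'a::real_normed_vector) \<Rightarrow> ((nat \<Rightarrow> int) \<times> nat \<Rightarrow> 'a)" where
  "D_long m n F = (\<lambda>(x, j). if x \<in> G m n \<and> j \<in> {1..n}
     then F (translate m n x (\<lambda>i. int m * basis_vec j i)) - F x else 0)"

definition D_sgn :: "nat \<Rightarrow> nat \<Rightarrow> ((nat \<Rightarrow> int) \<Rightarrow> 'a::real_normed_vector) \<Rightarrow> ((nat \<Rightarrow> int) \<times> (nat \<Rightarrow> int) \<Rightarrow> 'a)" where
  "D_sgn m n F = (\<lambda>(x, e). if x \<in> G m n \<and> e \<in> signs n
     then F (translate m n x e) - F x else 0)"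

definition D_long_adj :: "nat \<Rightarrow> nat \<Rightarrow> ((nat \<Rightarrow> int) \<times> nat \<Rightarrow> 'b::real_normed_vector) \<Rightarrow> ((nat \<Rightarrow> int) \<Rightarrow> 'b)" where
  "D_long_adj m n g = (\<lambda>x. if x \<in> G m n
     then (1 / real n) *\<^sub>R (\<Sum>j=1..n. g (translate m n x (\<lambda>i. - (int m * basis_vec j i)), j) - g (x, j))
     else 0)"

definition D_sgn_adj :: "nat \<Rightarrow> nat \<Rightarrow> ((nat \<Rightarrow> int) \<times> (nat \<Rightarrow> int) \<Rightarrow> 'b::real_normed_vector) \<Rightarrow> ((nat \<Rightarrow> int) \<Rightarrow> 'b)" where
  "D_sgn_adj m n h = (\<lambda>x. if x \<in> G m n
     then (1 / 2 ^ n) *\<^sub>R (\<Sum>e\<in>signs n. h (translate m n x (\<lambda>i. - e i), e) - h (x, e))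
     else 0)"

text \<open>The first argument of \<open>C_const\<close> only carries the type of the Banach space \<open>X\<close>. The
  supremum is taken in \<^typ>\<open>ennreal\<close>, where the empty supremum is \<open>0\<close>.\<close>

definition C_const :: "'a::real_normed_vector itself \<Rightarrow> real \<Rightarrow> nat \<Rightarrow> nat \<Rightarrow> ennreal" where
  "C_const X p n m =
     (if {F \<in> maps (G m n). D_sgn m n F = (\<lambda>_. 0 :: 'a)} \<subseteq> {F \<in> maps (G m n). D_long m n F = (\<lambda>_. 0)}
      then SUP F \<in> {F \<in> maps (G m n). D_sgn m n F \<noteq> (\<lambda>_. 0 :: 'a)}.
             ennreal (Lnorm (ereal p) (G m n \<times> {1..n}) (D_long m n F) /
                      Lnorm (ereal p) (G m n \<times> signs n) (D_sgn m n F))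
      else \<infinity>)"


section \<open>Solution fibres and their selections\<close>

definition fibre :: "nat \<Rightarrow> nat \<Rightarrow> ((nat \<Rightarrow> int) \<times> nat \<Rightarrow> 'b::real_normed_vector)
    \<Rightarrow> ((nat \<Rightarrow> int) \<times> (nat \<Rightarrow> int) \<Rightarrow> 'b) set" where
  "fibre m n g = {h \<in> maps (G m n \<times> signs n). D_sgn_adj m n h = D_long_adj m n g}"

definition selection :: "nat \<Rightarrow> nat \<Rightarrow> (((nat \<Rightarrow> int) \<times> nat \<Rightarrow> 'b::real_normed_vector)
    \<Rightarrow> ((nat \<Rightarrow> int) \<times> (nat \<Rightarrow> int) \<Rightarrow> 'b)) \<Rightarrow> bool" where
  "selection m n \<Phi> \<longleftrightarrow> (\<forall>g \<in> maps (G m n \<times> {1..n}). \<Phi> g \<in> fibre m n g)"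

definition odd_on :: "('v \<Rightarrow> 'b::real_normed_vector) set \<Rightarrow> (('v \<Rightarrow> 'b) \<Rightarrow> ('w \<Rightarrow> 'b)) \<Rightarrow> bool" where
  "odd_on L \<Phi> \<longleftrightarrow> (\<forall>g \<in> L. \<Phi> (\<lambda>v. - g v) = (\<lambda>w. - \<Phi> g w))"

definition pos_homogeneous_on :: "('v \<Rightarrow> 'b::real_normed_vector) set \<Rightarrow> (('v \<Rightarrow> 'b) \<Rightarrow> ('w \<Rightarrow> 'b)) \<Rightarrow> bool" where
  "pos_homogeneous_on L \<Phi> \<longleftrightarrow>
     (\<forall>g \<in> L. \<forall>t::real. 0 \<le> t \<longrightarrow> \<Phi> (\<lambda>v. t *\<^sub>R g v) = (\<lambda>w. t *\<^sub>R \<Phi> g w))"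

end

theory Submission
  imports Defs "HOL-Library.Function_Algebras"
begin

text \<open>The solution fibres are closed affine subspaces of a finite-dimensional space, and \<open>C\<close> below stands
  for the constant \<open>C_const\<close>. Three facts give the theorem.

  By duality, every fibre contains an element of norm at most \<open>C\<close> times the norm of \<open>g\<close>. The definition of \<open>C\<close> says that
  \<open>D\<^sub>s\<^sub>g\<^sub>n F \<mapsto> \<langle>D\<^sub>l\<^sub>o\<^sub>n\<^sub>g F, g\<rangle>\<close> is a well-defined functional on the range of \<open>D\<^sub>s\<^sub>g\<^sub>n\<close>, bounded by \<open>C\<close> times
  the norm of \<open>g\<close> (Hoelder's inequality). A Hahn--Banach extension to \<open>L\<^sub>p(G \<times> \<Sigma>; X)\<close> is represented by a map \<open>h\<close> with values in the
  dual space, and summation by parts turns the fact that it extends the functional into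
  \<open>D\<^sub>s\<^sub>g\<^sub>n\<^sup>* h = D\<^sub>l\<^sub>o\<^sub>n\<^sub>g\<^sup>* g\<close> (\<open>adjoint_solution_exists\<close>, \<open>fibre_bounded_solution\<close>).

  For the first selection, each fibre has an element of least norm by compactness. Scaling by a nonzero real maps
  minimal elements to minimal elements, so the minimal elements can be chosen once on every line through
  the origin and transported along it (\<open>odd_homogeneous_choice\<close>).

  For the continuous selection, local selections with nearly optimal norm are glued. A bounded linear but
  inefficient lift \<open>L\<close> exists because the space of all \<open>g\<close> has a finite spanning set
  (\<open>linear_continuous_lift\<close>). Around a point \<open>x\<close> of the unit sphere one adds \<open>L (g - x)\<close> to a good element of the fibre of
  \<open>x\<close>; a partition of unity over a finite net of the compact sphere combines these selections, because
  fibres are convex (\<open>continuous_homogeneous_selection\<close>). Antisymmetrising gives oddness.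

  Since everything lives on finite sets, the norm topologies agree with pointwise convergence
  (\<open>Ltopology_eq_product\<close>), in which compactness is Tychonoff's theorem.\<close>

section \<open>Compactness in function spaces\<close>

text \<open>Tychonoff's theorem for a box. The maps on a finite set \<open>\<Omega>\<close> are total functions that vanish outside
  \<open>\<Omega>\<close>, so the box has infinitely many factors, but those outside \<open>\<Omega>\<close> are single points.\<close>

lemma compact_coordinatewise:
  fixes S :: "'i \<Rightarrow> 'b::topological_space set"
  assumes "\<And>i. compact (S i)"
  shows "compact {f. \<forall>i. f i \<in> S i}"
proof -
  have "compactin (product_topology (\<lambda>_. euclidean) UNIV) (Pi\<^sub>E UNIV S)"
    using assms by (simp add: compactin_PiE)
  moreover have "Pi\<^sub>E UNIV S = {f. \<forall>i. f i \<in> S i}" by auto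
  ultimately show ?thesis by (simp add: euclidean_product_topology)
qed

lemma closed_level_set:
  fixes f :: "'c::topological_space \<Rightarrow> 'd::t1_space"
  assumes "continuous_on UNIV f"
  shows "closed {x. f x = a}"
  using closed_vimage[OF closed_singleton[of a] assms] by (simp add: vimage_def)

section \<open>Normed spaces spanned by a finite set\<close>

text \<open>All norms on a finite-dimensional space are equivalent: on the compact sphere
  \<open>\<Sum>\<bar>a\<^sub>b\<bar> = 1\<close> of coefficient vectors the norm of \<open>\<Sum>a\<^sub>b b\<close> has a positive minimum \<open>K\<close>, and scaling
  bounds every coordinate of \<open>x\<close> by \<open>norm x / K\<close>. Boundedness of the coordinate functionals is the form in which
  finite dimension is used below.\<close>

lemma finite_dim_coordinates:
  fixes B :: "'b::real_normed_vector set"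
  assumes "finite B" "span B = UNIV"
  obtains I and c :: "'b \<Rightarrow> 'b \<Rightarrow> real" where "finite I" "\<And>b. bounded_linear (c b)"
    "\<And>x. (\<Sum>b\<in>I. c b x *\<^sub>R b) = x"
proof -
  obtain I where I: "I \<subseteq> B" "independent I" "B \<subseteq> span I"
    using maximal_independent_subset[of B] by metis
  have fin: "finite I" using I(1) assms(1) finite_subset by blast
  have sp: "x \<in> span I" for x
    using span_mono[OF I(3)] assms(2) by (auto simp: span_span)
  define c where "c = (\<lambda>b x. representation I x b)"
  have rep: "(\<Sum>b\<in>I. c b x *\<^sub>R b) = x" for x
    unfolding c_def by (rule sum_representation_eq[OF I(2) sp fin subset_refl])
  define T where "T = (\<lambda>a::'b \<Rightarrow> real. \<Sum>b\<in>I. a b *\<^sub>R b)"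
  have T_scale: "T (\<lambda>b. t * a b) = t *\<^sub>R T a" for t a
    by (simp add: T_def scaleR_sum_right)
  have Tcont: "continuous_on A (\<lambda>a. norm (T a))" for A
    unfolding T_def
    by (intro continuous_intros continuous_on_subset[OF continuous_on_product_coordinates]) auto
  define S where "S = {a::'b \<Rightarrow> real. \<forall>b. a b \<in> (if b \<in> I then {-1..1} else {0})} \<inter> {a. (\<Sum>b\<in>I. \<bar>a b\<bar>) = 1}"
  have "compact S"
    unfolding S_def
    by (intro compact_Int_closed compact_coordinatewise closed_level_set continuous_intros continuous_on_product_coordinates) auto
  have T_pos: "norm (T a) > 0" if "a \<in> S" for a
  proof -
    have "(\<Sum>b\<in>I. \<bar>a b\<bar>) \<noteq> 0" using that by (simp add: S_def)
    then obtain b where b: "b \<in> I" "a b \<noteq> 0"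
      by (metis (mono_tags, lifting) abs_zero sum.neutral)
    then have "T a \<noteq> 0"
      using I(2) fin by (auto simp: T_def dependent_finite)
    then show ?thesis by simp
  qed
  have "\<exists>K>0. \<forall>a\<in>S. K \<le> norm (T a)"
  proof (cases "S = {}")
    case False
    then obtain a0 where "a0 \<in> S" "\<forall>a\<in>S. norm (T a0) \<le> norm (T a)"
      using continuous_attains_inf[OF \<open>compact S\<close> False Tcont] by metis
    then show ?thesis using T_pos by blast
  qed (auto intro: exI[of _ 1])
  then obtain K where K: "K > 0" "\<And>a. a \<in> S \<Longrightarrow> K \<le> norm (T a)" by blast
  have bound: "\<bar>c b x\<bar> \<le> norm x * (1 / K)" for b x
  proof (cases "b \<in> I")
    case True
    define s where "s = (\<Sum>b\<in>I. \<bar>c b x\<bar>)"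
    have cs: "\<bar>c b x\<bar> \<le> s" if "b \<in> I" for b
      unfolding s_def using that fin by (intro member_le_sum) auto
    show ?thesis
    proof (cases "s = 0")
      case True
      then show ?thesis using cs[OF \<open>b \<in> I\<close>] K by (simp add: order.trans[OF _ divide_nonneg_pos])
    next
      case False
      then have s: "s > 0" using cs[OF True] by linarith
      have "(1 / s) * c b x \<in> {-1..1}" if "b \<in> I" for b
        using cs[OF that] s by (simp add: divide_simps abs_le_iff)
      moreover have "(1 / s) * c b x = 0" if "b \<notin> I" for b
        using that representation_ne_zero[of I x b] by (auto simp: c_def)
      moreover have "(\<Sum>b\<in>I. \<bar>(1 / s) * c b x\<bar>) = 1"
      proof -
        have "(\<Sum>b\<in>I. \<bar>(1 / s) * c b x\<bar>) = (1 / s) * s"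
          unfolding s_def sum_distrib_left by (simp add: abs_mult sum_nonneg)
        then show ?thesis using s by simp
      qed
      ultimately have "(\<lambda>b. (1 / s) * c b x) \<in> S"
        by (simp add: S_def)
      then have "K \<le> norm ((1 / s) *\<^sub>R T (\<lambda>b. c b x))"
        using K(2) T_scale by metis
      also have "T (\<lambda>b. c b x) = x" using rep by (simp add: T_def)
      finally have "s \<le> norm x / K" using s K(1) by (simp add: field_simps)
      then show ?thesis using cs[OF True] by simp
    qed
  next
    case False
    then have "c b x = 0" using representation_ne_zero[of I x b] by (auto simp: c_def)
    then show ?thesis using K by simp
  qed
  have "bounded_linear (c b)" for b
  proof (rule bounded_linear_intro[of _ "1 / K"])
    show "c b (x + y) = c b x + c b y" for x y
      by (simp add: c_def representation_add[OF I(2) sp sp])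
    show "c b (r *\<^sub>R x) = r *\<^sub>R c b x" for r x
      by (simp add: c_def representation_scale[OF I(2) sp])
  qed (use bound in simp)
  with fin rep show ?thesis by (intro that) auto
qed

text \<open>The ball is a closed subset of the continuous image of a box of coefficients.\<close>

lemma compact_cball_finite_dim:
  fixes B :: "'b::real_normed_vector set"
  assumes "finite B" "span B = UNIV"
  shows "compact (cball (0::'b) R)"
proof -
  obtain I and c :: "'b \<Rightarrow> 'b \<Rightarrow> real" where I: "finite I" "\<And>b. bounded_linear (c b)"
    "\<And>x. (\<Sum>b\<in>I. c b x *\<^sub>R b) = x" using finite_dim_coordinates[OF assms] by blast
  define Q where "Q = {a. \<forall>b. a b \<in> {- (onorm (c b) * R) .. onorm (c b) * R}}"
  have "compact ((\<lambda>a. \<Sum>b\<in>I. a b *\<^sub>R b) ` Q)"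
    unfolding Q_def
    by (intro compact_continuous_image compact_coordinatewise continuous_intros
        continuous_on_subset[OF continuous_on_product_coordinates]) auto
  moreover have "cball 0 R \<subseteq> (\<lambda>a. \<Sum>b\<in>I. a b *\<^sub>R b) ` Q"
  proof
    fix x :: 'b assume x: "x \<in> cball 0 R"
    have bd: "\<bar>c b x\<bar> \<le> onorm (c b) * R" for b
    proof -
      have "\<bar>c b x\<bar> \<le> onorm (c b) * norm x" using onorm[OF I(2), of b x] by simp
      also have "\<dots> \<le> onorm (c b) * R"
        using x by (intro mult_left_mono onorm_pos_le[OF I(2)]) simp
      finally show ?thesis .
    qed
    have "- (onorm (c b) * R) \<le> c b x \<and> c b x \<le> onorm (c b) * R" for b
      using bd[of b] by linarith
    then have "(\<lambda>b. c b x) \<in> Q" by (simp add: Q_def)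
    then show "x \<in> (\<lambda>a. \<Sum>b\<in>I. a b *\<^sub>R b) ` Q" using I(3)[of x] by force
  qed
  then have "cball 0 R = (\<lambda>a. \<Sum>b\<in>I. a b *\<^sub>R b) ` Q \<inter> cball 0 R" by blast
  ultimately show ?thesis
    using compact_Int_closed[OF _ closed_cball, of "(\<lambda>a. \<Sum>b\<in>I. a b *\<^sub>R b) ` Q" 0 R] by simp
qed

text \<open>Every functional satisfies \<open>f = \<Sum>f(b) c\<^sub>b\<close>, so the coordinate functionals \<open>c\<^sub>b\<close> span the dual.\<close>

lemma dual_finite_dim:
  fixes B :: "'a::real_normed_vector set"
  assumes "finite B" "span B = UNIV"
  obtains D :: "('a \<Rightarrow>\<^sub>L real) set" where "finite D" "span D = UNIV"
proof -
  obtain I and c :: "'a \<Rightarrow> 'a \<Rightarrow> real" where I: "finite I" "\<And>b. bounded_linear (c b)"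
    "\<And>x. (\<Sum>b\<in>I. c b x *\<^sub>R b) = x" using finite_dim_coordinates[OF assms] by blast
  define D where "D = (\<lambda>b. Blinfun (c b)) ` I"
  have "f \<in> span D" for f
  proof -
    have "f = (\<Sum>b\<in>I. blinfun_apply f b *\<^sub>R Blinfun (c b))"
    proof (rule blinfun_eqI)
      fix x
      have "blinfun_apply f x = blinfun_apply f (\<Sum>b\<in>I. c b x *\<^sub>R b)" by (simp add: I(3))
      also have "\<dots> = (\<Sum>b\<in>I. c b x * blinfun_apply f b)"
        by (simp add: blinfun.sum_right blinfun.scaleR_right)
      finally show "blinfun_apply f x = blinfun_apply (\<Sum>b\<in>I. blinfun_apply f b *\<^sub>R Blinfun (c b)) x"
        by (simp add: blinfun.sum_left blinfun.scaleR_left bounded_linear_Blinfun_apply I(2) mult.commute)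
    qed
    also have "\<dots> \<in> span D"
      by (intro span_sum span_scale span_base) (auto simp: D_def)
    finally show ?thesis .
  qed
  with I(1) show ?thesis by (intro that[of D]) (auto simp: D_def)
qed

section \<open>The norm of \<open>L\<^sub>r(\<Omega>; Y)\<close>\<close>

text \<open>The pointwise vector space structure makes spans, subspaces and finite sums available for
  functions; every map in \<open>maps \<Omega>\<close> is a finite sum of maps supported at one point.\<close>

instantiation "fun" :: (type, real_vector) real_vector
begin

definition scaleR_fun :: "real \<Rightarrow> ('a \<Rightarrow> 'b) \<Rightarrow> 'a \<Rightarrow> 'b" where
  "scaleR_fun t f = (\<lambda>x. t *\<^sub>R f x)"

instance
  by standard (simp_all add: scaleR_fun_def fun_eq_iff algebra_simps)

end

lemma scaleR_fun_apply [simp]: "(t *\<^sub>R f) x = t *\<^sub>R f x"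
  by (simp add: scaleR_fun_def)

lemma subspace_maps: "subspace (maps \<Omega>)"
  by (simp add: subspace_def maps_def)

lemma Lnorm_add_le:
  assumes "1 \<le> r" "finite \<Omega>" "\<Omega> \<noteq> {}"
  shows "Lnorm r \<Omega> (F + H) \<le> Lnorm r \<Omega> F + Lnorm r \<Omega> H"
  using Lnorm_triangle[OF assms, of F H] by (simp add: plus_fun_def)

lemma Lnorm_scaleR:
  assumes "1 \<le> r" "finite \<Omega>" "\<Omega> \<noteq> {}"
  shows "Lnorm r \<Omega> (t *\<^sub>R F) = \<bar>t\<bar> * Lnorm r \<Omega> F"
proof (cases r)
  case (real s)
  with assms have s: "1 \<le> s" by simp
  have "(\<Sum>w\<in>\<Omega>. norm (t *\<^sub>R F w) powr s) = \<bar>t\<bar> powr s * (\<Sum>w\<in>\<Omega>. norm (F w) powr s)"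
    by (simp add: powr_mult sum_distrib_left)
  moreover have "(\<bar>t\<bar> powr s) powr (1/s) = \<bar>t\<bar>"
    using s by (simp add: powr_powr)
  ultimately show ?thesis
    using real by (simp add: Lnorm_def powr_mult flip: times_divide_eq_right)
next
  case PInf
  have "mono (\<lambda>x::real. \<bar>t\<bar> * x)" by (intro monoI mult_left_mono) auto
  from mono_Max_commute[OF this, of "(\<lambda>w. norm (F w)) ` \<Omega>"] show ?thesis
    using PInf assms by (simp add: Lnorm_def image_image)
qed (use assms in simp)

lemma Lnorm_zero: "1 \<le> r \<Longrightarrow> finite \<Omega> \<Longrightarrow> \<Omega> \<noteq> {} \<Longrightarrow> Lnorm r \<Omega> 0 = 0"
  by (simp add: Lnorm_eq_0_iff)

lemma Lnorm_minus:
  assumes "1 \<le> r" "finite \<Omega>" "\<Omega> \<noteq> {}"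
  shows "Lnorm r \<Omega> (- F) = Lnorm r \<Omega> F"
  using Lnorm_scaleR[OF assms, of "-1" F] by simp

lemma Lnorm_sum_le:
  fixes f :: "'i \<Rightarrow> 'w \<Rightarrow> 'b::real_normed_vector"
  assumes "1 \<le> r" "finite \<Omega>" "\<Omega> \<noteq> {}"
  shows "Lnorm r \<Omega> (\<Sum>i\<in>I. f i) \<le> (\<Sum>i\<in>I. Lnorm r \<Omega> (f i))"
  supply [[show_types]]
proof (induction I rule: infinite_finite_induct)
  case (insert i I)
  then have "Lnorm r \<Omega> (f i) + Lnorm r \<Omega> (sum f I) \<le> (\<Sum>i\<in>insert i I. Lnorm r \<Omega> (f i))"
    by simp
  then show ?case
    unfolding sum.insert[OF insert(1,2)] using Lnorm_add_le[OF assms, of "f i" "sum f I"] by linarith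
next
  case (infinite I)
  then show ?case using Lnorm_zero[OF assms] unfolding sum.infinite[OF infinite] by (metis order_refl)
next
  case empty
  show ?case using Lnorm_zero[OF assms] unfolding sum.empty by (metis order_refl)
qed

text \<open>The constant is far from optimal, but it is the same for all exponents, including \<open>\<infinity>\<close>; it serves only
  to compare the norm with pointwise convergence.\<close>

lemma norm_le_Lnorm:
  assumes "1 \<le> r" "finite \<Omega>" "w \<in> \<Omega>"
  shows "norm (F w) \<le> real (card \<Omega>) * Lnorm r \<Omega> F"
proof -
  have ne: "\<Omega> \<noteq> {}" using assms by auto
  have N: "1 \<le> real (card \<Omega>)"
    using assms ne by (simp add: card_gt_0_iff Suc_le_eq)
  show ?thesis
  proof (cases r)
    case (real s)
    with assms have s: "1 \<le> s" by simp
    let ?L = "Lnorm r \<Omega> F"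
    have L: "0 \<le> ?L" using Lnorm_nonneg assms ne by auto
    have "norm (F w) powr s \<le> (\<Sum>w\<in>\<Omega>. norm (F w) powr s)"
      using assms by (intro member_le_sum) auto
    also have "\<dots> = real (card \<Omega>) * ?L powr s"
      using Lnorm_powr[OF s assms(2) ne, of F] N real by (simp add: field_simps)
    also have "\<dots> \<le> real (card \<Omega>) powr s * ?L powr s"
      using powr_mono[OF s N] N by (intro mult_right_mono) auto
    also have "\<dots> = (real (card \<Omega>) * ?L) powr s"
      by (simp add: powr_mult)
    finally have le: "(norm (F w) powr s) powr (1/s) \<le> ((real (card \<Omega>) * ?L) powr s) powr (1/s)"
      using s by (rule_tac powr_mono2) auto
    have inv: "(y powr s) powr (1/s) = y" if "0 \<le> y" for y :: real
      using s that by (simp add: powr_powr)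
    have "norm (F w) = (norm (F w) powr s) powr (1/s)" by (rule inv[symmetric]) simp
    also note le
    also have "((real (card \<Omega>) * ?L) powr s) powr (1/s) = real (card \<Omega>) * ?L"
      by (rule inv) (use L in simp)
    finally show ?thesis .
  next
    case PInf
    have "norm (F w) \<le> Lnorm r \<Omega> F" using PInf assms by (simp add: Lnorm_def)
    also have "\<dots> \<le> real (card \<Omega>) * Lnorm r \<Omega> F"
      using N Lnorm_nonneg[OF assms(2) ne, of r F] mult_right_mono[of 1 "real (card \<Omega>)" "Lnorm r \<Omega> F"] by simp
    finally show ?thesis .
  qed (use assms in simp)
qed

lemma continuous_on_Max_image:
  fixes f :: "'i \<Rightarrow> 'c::topological_space \<Rightarrow> real"
  assumes "finite I" "I \<noteq> {}" "\<And>i. i \<in> I \<Longrightarrow> continuous_on S (f i)"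
  shows "continuous_on S (\<lambda>x. Max ((\<lambda>i. f i x) ` I))"
  using assms
proof (induction rule: finite_ne_induct)
  case (insert i I)
  then have "continuous_on S (\<lambda>x. max (f i x) (Max ((\<lambda>i. f i x) ` I)))"
    by (intro continuous_on_max) auto
  then show ?case using insert by simp
qed simp

lemma continuous_on_eval: "continuous_on S (\<lambda>F. F w)"
  using continuous_on_subset[OF continuous_on_product_coordinates] by auto

lemma continuous_on_Lnorm:
  assumes "1 \<le> r" "finite \<Omega>" "\<Omega> \<noteq> {}"
  shows "continuous_on S (Lnorm r \<Omega>)"
proof (cases r)
  case (real s)
  with assms have "1 \<le> s" by simp
  then show ?thesis
    unfolding Lnorm_def[abs_def] using real assms
    by (auto intro!: continuous_intros continuous_on_powr' continuous_on_eval divide_nonneg_nonneg sum_nonneg)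
next
  case PInf
  then show ?thesis
    unfolding Lnorm_def[abs_def] using assms
    by (auto intro!: continuous_on_Max_image continuous_intros continuous_on_eval)
qed (use assms in simp)

lemma continuous_on_Lnorm_comp:
  assumes "1 \<le> r" "finite \<Omega>" "\<Omega> \<noteq> {}" and f: "\<And>w. continuous_on S (\<lambda>x. f x w)"
  shows "continuous_on S (\<lambda>x. Lnorm r \<Omega> (f x))"
  using continuous_on_compose2[OF continuous_on_Lnorm[OF assms(1-3), of UNIV], of S f]
    continuous_on_coordinatewise_then_product[of S f] f by simp

lemma closed_maps: "closed (maps \<Omega> :: ('w \<Rightarrow> 'b::real_normed_vector) set)"
proof -
  have "closed {F :: 'w \<Rightarrow> 'b. F w = 0}" for w
    by (rule closed_level_set[where f = "\<lambda>F. F w"]) (rule continuous_on_product_coordinates)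
  then have "closed (\<Inter>w\<in>-\<Omega>. {F :: 'w \<Rightarrow> 'b. F w = 0})" by (intro closed_INT) auto
  also have "(\<Inter>w\<in>-\<Omega>. {F. F w = 0}) = maps \<Omega>" by (auto simp: maps_def)
  finally show ?thesis .
qed

text \<open>A norm ball of \<open>L\<^sub>r(\<Omega>; Y)\<close> is closed for pointwise convergence and lies in a product of balls of \<open>Y\<close>.\<close>

lemma compact_Lnorm_ball:
  fixes C :: "'b::real_normed_vector set"
  assumes "1 \<le> r" "finite \<Omega>" "\<Omega> \<noteq> {}" "finite C" "span C = UNIV"
  shows "compact (maps \<Omega> \<inter> {F. Lnorm r \<Omega> (F :: 'w \<Rightarrow> 'b) \<le> R})"
proof -
  let ?S = "\<lambda>w. if w \<in> \<Omega> then cball (0::'b) (real (card \<Omega>) * R) else {0}"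
  have "compact {F. \<forall>w. F w \<in> ?S w}"
    using compact_cball_finite_dim[OF assms(4,5)] by (intro compact_coordinatewise) auto
  moreover have "closed (maps \<Omega> \<inter> {F. Lnorm r \<Omega> (F :: 'w \<Rightarrow> 'b) \<le> R})"
    by (intro closed_Int closed_maps closed_Collect_le continuous_on_Lnorm continuous_intros assms)
  ultimately have "compact ({F. \<forall>w. F w \<in> ?S w} \<inter> (maps \<Omega> \<inter> {F. Lnorm r \<Omega> (F :: 'w \<Rightarrow> 'b) \<le> R}))"
    by (rule compact_Int_closed)
  moreover have "norm (F w) \<le> real (card \<Omega>) * R" if "Lnorm r \<Omega> F \<le> R" "w \<in> \<Omega>" for F :: "'w \<Rightarrow> 'b" and w
    using norm_le_Lnorm[OF assms(1,2) that(2), of F] mult_left_mono[OF that(1), of "real (card \<Omega>)"] by simp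
  then have "{F. \<forall>w. F w \<in> ?S w} \<inter> (maps \<Omega> \<inter> {F. Lnorm r \<Omega> (F :: 'w \<Rightarrow> 'b) \<le> R})
      = maps \<Omega> \<inter> {F. Lnorm r \<Omega> F \<le> R}"
    by (auto simp: maps_def)
  ultimately show ?thesis by simp
qed

text \<open>On a finite set, convergence in \<open>L\<^sub>r\<close> is pointwise convergence: the norm is a continuous
  function of the finitely many values and it controls each of them. Continuity of a selection can
  therefore be checked one value at a time.\<close>

lemma Ltopology_eq_product:
  assumes "1 \<le> r" "finite \<Omega>" "\<Omega> \<noteq> {}"
  shows "Ltopology r \<Omega> = top_of_set (maps \<Omega> :: ('w \<Rightarrow> 'b::real_normed_vector) set)"
proof -
  interpret Metric_space "maps \<Omega> :: ('w \<Rightarrow> 'b) set" "Ldist r \<Omega>"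
    by (rule Metric_space_Ldist[OF assms])
  have top: "Ltopology r \<Omega> = (mtopology :: ('w \<Rightarrow> 'b) topology)" by (simp add: Ltopology_def)
  have dist: "Ldist r \<Omega> F H = Lnorm r \<Omega> (H - F)" for F H :: "'w \<Rightarrow> 'b"
    using commute[of F H] by (simp add: Ldist_def fun_diff_def)
  show ?thesis
  proof (rule topology_eq[THEN iffD2], intro allI iffI)
    fix U :: "('w \<Rightarrow> 'b) set"
    assume U: "openin (Ltopology r \<Omega>) U"
    show "openin (top_of_set (maps \<Omega>)) U"
    proof (subst openin_subopen, intro ballI)
      fix F assume F: "F \<in> U"
      then obtain e where e: "e > 0" "mball F e \<subseteq> U" "F \<in> maps \<Omega>"
        using U unfolding top openin_mtopology by blast
      have "continuous_on UNIV (\<lambda>H. (H - F) w)" for w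
        unfolding minus_apply by (intro continuous_intros continuous_on_product_coordinates)
      then have "open {H. Lnorm r \<Omega> (H - F) < e}"
        by (intro open_Collect_less continuous_on_Lnorm_comp[OF assms] continuous_on_const)
      moreover have "mball F e = maps \<Omega> \<inter> {H. Lnorm r \<Omega> (H - F) < e}"
        using e(3) by (auto simp: mball_def dist)
      moreover have "Lnorm r \<Omega> (F - F) = 0" by (simp add: Lnorm_eq_0_iff[OF assms])
      ultimately show "\<exists>T. openin (top_of_set (maps \<Omega>)) T \<and> F \<in> T \<and> T \<subseteq> U"
        using e by (intro exI[of _ "mball F e"]) auto
    qed
  next
    fix U :: "('w \<Rightarrow> 'b) set"
    assume U: "openin (top_of_set (maps \<Omega>)) U"
    have eval: "continuous_map mtopology euclidean (\<lambda>F :: 'w \<Rightarrow> 'b. F w)" for w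
    proof (cases "w \<in> \<Omega>")
      case True
      define N where "N = real (card \<Omega>)"
      have N: "N > 0" using assms by (simp add: N_def card_gt_0_iff)
      have "\<exists>\<delta>>0. \<forall>H. H \<in> maps \<Omega> \<and> Ldist r \<Omega> F H < \<delta> \<longrightarrow> dist (F w) (H w) < e"
        if "e > 0" for F :: "'w \<Rightarrow> 'b" and e
      proof (intro exI conjI allI impI)
        show "e / N > 0" using that N by simp
        fix H :: "'w \<Rightarrow> 'b" assume "H \<in> maps \<Omega> \<and> Ldist r \<Omega> F H < e / N"
        then have "N * Lnorm r \<Omega> (H - F) < e" using N by (simp add: dist field_simps)
        then show "dist (F w) (H w) < e"
          using norm_le_Lnorm[OF assms(1,2) True, of "H - F"]
          by (simp add: N_def dist_norm norm_minus_commute)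
      qed
      then have "continuous_map mtopology (Metric_space.mtopology UNIV dist) (\<lambda>F :: 'w \<Rightarrow> 'b. F w)"
        by (subst metric_continuous_map) (auto simp: Met_TC.Metric_space_axioms)
      then show ?thesis by simp
    next
      case False
      then have "0 = F w" if "F \<in> topspace mtopology" for F :: "'w \<Rightarrow> 'b"
        using that unfolding topspace_mtopology by (simp add: maps_def)
      moreover have "continuous_map mtopology euclidean (\<lambda>F :: 'w \<Rightarrow> 'b. 0 :: 'b)" by simp
      ultimately show ?thesis by (rule continuous_map_eq[rotated])
    qed
    have "continuous_map mtopology (product_topology (\<lambda>_. euclidean) UNIV) (\<lambda>F :: 'w \<Rightarrow> 'b. F)"
      using eval unfolding continuous_map_componentwise_UNIV by blast
    then have "continuous_map mtopology (top_of_set (maps \<Omega>)) (\<lambda>F :: 'w \<Rightarrow> 'b. F)"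
      by (simp add: euclidean_product_topology continuous_map_in_subtopology)
    then have "openin mtopology {F \<in> topspace mtopology. F \<in> U}"
      using U openin_continuous_map_preimage by fast
    moreover have "{F \<in> topspace mtopology. F \<in> U} = U"
      using openin_subset[OF U] by auto
    ultimately show "openin (Ltopology r \<Omega>) U" by (simp add: top)
  qed
qed

section \<open>Dominated extension of linear functionals\<close>

definition sublinear :: "('v::real_vector \<Rightarrow> real) \<Rightarrow> bool" where
  "sublinear q \<longleftrightarrow> (\<forall>u v. q (u + v) \<le> q u + q v) \<and> (\<forall>t u. 0 \<le> t \<longrightarrow> q (t *\<^sub>R u) = t * q u)"

lemma sublinear_add: "sublinear q \<Longrightarrow> q (u + v) \<le> q u + q v"
  and sublinear_scaleR: "sublinear q \<Longrightarrow> 0 \<le> t \<Longrightarrow> q (t *\<^sub>R u) = t * q u"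
  by (auto simp: sublinear_def)

lemma sublinear_0: "sublinear q \<Longrightarrow> q 0 = 0"
  using sublinear_scaleR[of q 0 0] by simp

lemma sublinear_minus: "sublinear q \<Longrightarrow> 0 \<le> q u + q (- u)"
  using sublinear_add[of q u "- u"] sublinear_0[of q] by simp

text \<open>The minorant is \<open>q'(u) = inf (q(u + v) - s)\<close> over the cone \<open>R\<close> of prescribed values: a pair \<open>(v, s)\<close>
  asks for a functional with \<open>s \<le> l(v)\<close>, and every linear \<open>l \<le> q'\<close> satisfies this because
  \<open>- l(v) = l(- v) \<le> q'(- v) \<le> - s\<close>. The infimum is finite because \<open>s \<le> q(v)\<close>.\<close>

lemma sublinear_minorant:
  fixes q :: "'v::real_vector \<Rightarrow> real"
  assumes q: "sublinear q" and R0: "(0, 0) \<in> R"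
    and R_add: "\<And>v s v' s'. (v, s) \<in> R \<Longrightarrow> (v', s') \<in> R \<Longrightarrow> (v + v', s + s') \<in> R"
    and R_scale: "\<And>v s t. (v, s) \<in> R \<Longrightarrow> 0 \<le> t \<Longrightarrow> (t *\<^sub>R v, t * s) \<in> R"
    and le: "\<And>v s. (v, s) \<in> R \<Longrightarrow> s \<le> q v"
  obtains q' where "sublinear q'" "\<And>u. q' u \<le> q u" "\<And>v s. (v, s) \<in> R \<Longrightarrow> q' (- v) \<le> - s"
proof -
  define f where "f = (\<lambda>u (v, s). q (u + v) - s)"
  define q' where "q' = (\<lambda>u. INF x\<in>R. f u x)"
  have ne: "R \<noteq> {}" using R0 by auto
  have low: "- q (- u) \<le> f u x" if "x \<in> R" for u x
  proof -
    obtain v s where x: "x = (v, s)" by (cases x)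
    have "s \<le> q ((u + v) + (- u))" using le that x by simp
    also have "\<dots> \<le> q (u + v) + q (- u)" by (rule sublinear_add[OF q])
    finally show ?thesis by (simp add: x f_def)
  qed
  have bdd: "bdd_below (f u ` R)" for u
    using low by (intro bdd_belowI2[where m = "- q (- u)"])
  have lower: "q' u \<le> f u x" if "x \<in> R" for u x
    unfolding q'_def by (rule cINF_lower[OF bdd that])
  have greatest: "b \<le> q' u" if "\<And>x. x \<in> R \<Longrightarrow> b \<le> f u x" for b u
    unfolding q'_def by (rule cINF_greatest[OF ne that])
  have "q' (u + u') \<le> q' u + q' u'" for u u'
  proof -
    have "q' (u + u') \<le> f u x + f u' y" if "x \<in> R" "y \<in> R" for x y
    proof -
      obtain v s v' s' where xy: "x = (v, s)" "y = (v', s')" by (cases x, cases y)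
      have "q' (u + u') \<le> q ((u + u') + (v + v')) - (s + s')"
        using lower[OF R_add[of v s v' s']] that by (simp add: xy f_def)
      also have "(u + u') + (v + v') = (u + v) + (u' + v')" by simp
      also have "q \<dots> \<le> q (u + v) + q (u' + v')" by (rule sublinear_add[OF q])
      finally show ?thesis by (simp add: xy f_def)
    qed
    then have "q' (u + u') - f u x \<le> q' u'" if "x \<in> R" for x
      using that by (intro greatest) (simp add: diff_le_eq add.commute)
    then have "q' (u + u') - q' u' \<le> f u x" if "x \<in> R" for x
      using that by (smt (verit))
    then show ?thesis using greatest[of "q' (u + u') - q' u'" u] by simp
  qed
  moreover have scale_le: "q' (t *\<^sub>R u) \<le> t * q' u" if t: "0 < t" for t u
  proof -
    have "q' (t *\<^sub>R u) / t \<le> f u x" if "x \<in> R" for x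
    proof -
      obtain v s where x: "x = (v, s)" by (cases x)
      have "q' (t *\<^sub>R u) \<le> q (t *\<^sub>R u + t *\<^sub>R v) - t * s"
        using lower[OF R_scale[of v s t]] that t by (simp add: x f_def)
      also have "\<dots> = t * f u x"
        using sublinear_scaleR[OF q, of t "u + v"] t by (simp add: x f_def algebra_simps)
      finally show ?thesis using t by (simp add: divide_le_eq mult.commute)
    qed
    then have "q' (t *\<^sub>R u) / t \<le> q' u" by (rule greatest)
    then show ?thesis using t by (simp add: divide_le_eq mult.commute)
  qed
  have "q' (t *\<^sub>R u) = t * q' u" if "0 \<le> t" for t u
  proof (cases "t = 0")
    case True
    have "q' 0 \<le> 0" using lower[OF R0, of 0] sublinear_0[OF q] by (simp add: f_def)
    moreover have "0 \<le> q' 0" using greatest[of 0 0] low[of _ 0] sublinear_0[OF q] by simp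
    ultimately show ?thesis using True by simp
  next
    case False
    then have t: "0 < t" using that by simp
    then have "q' ((1 / t) *\<^sub>R t *\<^sub>R u) \<le> (1 / t) * q' (t *\<^sub>R u)" by (intro scale_le) simp
    then have "t * q' u \<le> q' (t *\<^sub>R u)" using t by (simp add: field_simps)
    then show ?thesis using scale_le[OF t, of u] by simp
  qed
  ultimately have "sublinear q'" by (simp add: sublinear_def)
  moreover have "q' u \<le> q u" for u using lower[OF R0, of u] by (simp add: f_def)
  moreover have "q' (- v) \<le> - s" if "(v, s) \<in> R" for v s
    using lower[OF that, of "- v"] sublinear_0[OF q] by (simp add: f_def)
  ultimately show ?thesis by (rule that)
qed

text \<open>The minorant for the ray of pairs \<open>(t b, t q(b))\<close> is odd at \<open>b\<close>, since its value at \<open>- b\<close> is at most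
  \<open>- q(b)\<close>. Oddness at earlier vectors survives a further decrease, as \<open>0 \<le> q(a) + q(- a)\<close> for every sublinear
  function. Hence finitely many such steps take the place of a transfinite argument.\<close>

lemma sublinear_minorant_odd_on:
  assumes "finite B" "sublinear q"
  shows "\<exists>q'. sublinear q' \<and> (\<forall>u. q' u \<le> q u) \<and> (\<forall>b\<in>B. q' (- b) = - q' b)"
  using assms(1)
proof (induction B rule: finite_induct)
  case empty
  then show ?case using assms(2) by auto
next
  case (insert b B)
  then obtain q1 where q1: "sublinear q1" "\<forall>u. q1 u \<le> q u" "\<forall>b\<in>B. q1 (- b) = - q1 b" by blast
  define R where "R = (\<lambda>t. (t *\<^sub>R b, t * q1 b)) ` {0..}"
  obtain q2 where q2: "sublinear q2" "\<And>u. q2 u \<le> q1 u" "\<And>v s. (v, s) \<in> R \<Longrightarrow> q2 (- v) \<le> - s"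
  proof (rule sublinear_minorant[OF q1(1), of R])
    show "(0, 0) \<in> R" by (force simp: R_def)
    show "(v + v', s + s') \<in> R" if "(v, s) \<in> R" "(v', s') \<in> R" for v s v' s'
    proof -
      obtain t t' where "0 \<le> t" "0 \<le> t'" "v = t *\<^sub>R b" "v' = t' *\<^sub>R b" "s = t * q1 b" "s' = t' * q1 b"
        using \<open>(v, s) \<in> R\<close> \<open>(v', s') \<in> R\<close> by (auto simp: R_def)
      then show ?thesis by (auto simp: R_def algebra_simps intro!: image_eqI[of _ _ "t + t'"])
    qed
    show "(t *\<^sub>R v, t * s) \<in> R" if "(v, s) \<in> R" "0 \<le> t" for v s t
    proof -
      obtain t' where "0 \<le> t'" "v = t' *\<^sub>R b" "s = t' * q1 b"
        using \<open>(v, s) \<in> R\<close> by (auto simp: R_def)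
      then show ?thesis using \<open>0 \<le> t\<close> by (auto simp: R_def intro!: image_eqI[of _ _ "t * t'"])
    qed
    show "s \<le> q1 v" if "(v, s) \<in> R" for v s
      using that sublinear_scaleR[OF q1(1)] by (auto simp: R_def)
  qed auto
  have "(b, q1 b) \<in> R" by (force simp: R_def)
  then have "q2 (- b) \<le> - q1 b" by (rule q2(3))
  then have "q2 (- b) = - q2 b"
    using q2(2)[of b] sublinear_minus[OF q2(1), of b] by linarith
  moreover have "q2 (- a) = - q2 a" if "a \<in> B" for a
    using q2(2)[of a] q2(2)[of "- a"] q1(3) that sublinear_minus[OF q2(1), of a] by fastforce
  ultimately show ?case
    using q2(1,2) q1(2) by (intro exI[of _ q2]) (auto intro: order_trans)
qed

text \<open>The vectors at which a sublinear function is odd form a subspace on which it is additive: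
  \<open>q(u) \<le> q(u + v) + q(- v)\<close> is the inequality opposite to subadditivity.\<close>

lemma sublinear_odd_imp_linear:
  assumes q: "sublinear q" and odd: "\<And>b. b \<in> B \<Longrightarrow> q (- b) = - q b"
  shows "u \<in> span B \<Longrightarrow> v \<in> span B \<Longrightarrow> q (u + v) = q u + q v"
    and "u \<in> span B \<Longrightarrow> q (t *\<^sub>R u) = t * q u"
proof -
  have add: "q (u + v) = q u + q v" if "q (- u) = - q u" "q (- v) = - q v" for u v
  proof -
    have "q u \<le> q (u + v) + q (- v)" using sublinear_add[OF q, of "u + v" "- v"] by simp
    then show ?thesis using sublinear_add[OF q, of u v] that by linarith
  qed
  have scale: "q (t *\<^sub>R u) = t * q u" if "q (- u) = - q u" for t u
  proof (cases "0 \<le> t")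
    case False
    then have "q ((- t) *\<^sub>R (- u)) = (- t) * q (- u)" by (intro sublinear_scaleR[OF q]) simp
    then show ?thesis using that by simp
  qed (rule sublinear_scaleR[OF q])
  have "subspace {u. q (- u) = - q u}"
  proof (rule subspaceI)
    show "0 \<in> {u. q (- u) = - q u}" using sublinear_0[OF q] by simp
    show "u + v \<in> {u. q (- u) = - q u}" if "u \<in> {u. q (- u) = - q u}" "v \<in> {u. q (- u) = - q u}" for u v
    proof -
      have "q ((- u) + (- v)) = q (- u) + q (- v)" using that by (intro add) auto
      then show ?thesis using that add[of u v] by (simp add: algebra_simps)
    qed
    show "t *\<^sub>R u \<in> {u. q (- u) = - q u}" if "u \<in> {u. q (- u) = - q u}" for t u
      using that scale[of u t] scale[of u "- t"] by simp
  qed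
  then have "q (- u) = - q u" if "u \<in> span B" for u
    using span_minimal[of B "{u. q (- u) = - q u}"] odd that by blast
  then show "u \<in> span B \<Longrightarrow> v \<in> span B \<Longrightarrow> q (u + v) = q u + q v"
    "u \<in> span B \<Longrightarrow> q (t *\<^sub>R u) = t * q u"
    using add scale by blast+
qed

text \<open>A Hahn--Banach theorem in the style of Mazur and Orlicz. The relation \<open>R\<close> is the graph of the functional to be
  extended; it need not be given as a function, which is convenient when the functional is defined on
  the range of an operator.\<close>

theorem dominated_functional_exists:
  fixes q :: "'v::real_vector \<Rightarrow> real"
  assumes q: "sublinear q" and R0: "(0, 0) \<in> R"
    and R_add: "\<And>v s v' s'. (v, s) \<in> R \<Longrightarrow> (v', s') \<in> R \<Longrightarrow> (v + v', s + s') \<in> R"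
    and R_scale: "\<And>v s t. (v, s) \<in> R \<Longrightarrow> (t *\<^sub>R v, t * s) \<in> R"
    and le: "\<And>v s. (v, s) \<in> R \<Longrightarrow> s \<le> q v"
    and B: "finite B"
  obtains l where "\<And>u. l u \<le> q u" "\<And>v s. (v, s) \<in> R \<Longrightarrow> v \<in> span B \<Longrightarrow> l v = s"
    "\<And>u v. u \<in> span B \<Longrightarrow> v \<in> span B \<Longrightarrow> l (u + v) = l u + l v"
    "\<And>t u. u \<in> span B \<Longrightarrow> l (t *\<^sub>R u) = t * l u"
proof -
  obtain q1 where q1: "sublinear q1" "\<And>u. q1 u \<le> q u" "\<And>v s. (v, s) \<in> R \<Longrightarrow> q1 (- v) \<le> - s"
    using sublinear_minorant[OF q R0 R_add R_scale le] by metis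
  obtain l where l: "sublinear l" "\<And>u. l u \<le> q1 u" "\<And>b. b \<in> B \<Longrightarrow> l (- b) = - l b"
    using sublinear_minorant_odd_on[OF B q1(1)] by metis
  note lin = sublinear_odd_imp_linear[OF l(1) l(3)]
  have "l v = s" if R: "(v, s) \<in> R" and v: "v \<in> span B" for v s
  proof (rule antisym)
    have "(- v, - s) \<in> R" using R_scale[OF R, of "- 1"] by simp
    then show "l v \<le> s" using order_trans[OF l(2) q1(3), of "- v" "- s"] by simp
    have "- l v = l (- v)" using lin(2)[OF _ v, of "- 1"] by simp
    also have "\<dots> \<le> - s" using order_trans[OF l(2) q1(3)[OF R]] .
    finally show "s \<le> l v" by simp
  qed
  moreover have "l u \<le> q u" for u using order_trans[OF l(2) q1(2)] .
  ultimately show ?thesis using lin[of B] by (intro that[of l]) blast+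
qed

section \<open>Duality between \<open>L\<^sub>p(\<Omega>; X)\<close> and \<open>L\<^sub>p\<^sub>'(\<Omega>; X\<^sup>*)\<close>\<close>

definition pairing :: "'w set \<Rightarrow> ('w \<Rightarrow> 'a::real_normed_vector) \<Rightarrow> ('w \<Rightarrow> 'a \<Rightarrow>\<^sub>L real) \<Rightarrow> real" where
  "pairing \<Omega> u h = (\<Sum>w\<in>\<Omega>. blinfun_apply (h w) (u w)) / real (card \<Omega>)"

definition point_map :: "'w \<Rightarrow> 'b \<Rightarrow> 'w \<Rightarrow> 'b::real_normed_vector" where
  "point_map w x = (\<lambda>v. if v = w then x else 0)"

lemma point_map_apply [simp]: "point_map w x w = x" "v \<noteq> w \<Longrightarrow> point_map w x v = 0"
  by (auto simp: point_map_def)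

lemma point_map_add: "point_map w (x + y) = point_map w x + point_map w y"
  and point_map_scaleR: "point_map w (t *\<^sub>R x) = t *\<^sub>R point_map w x"
  by (auto simp: point_map_def fun_eq_iff)

lemma point_map_in_maps: "w \<in> \<Omega> \<Longrightarrow> point_map w x \<in> maps \<Omega>"
  by (auto simp: point_map_def maps_def)

lemma sum_fun_apply: "sum f I x = (\<Sum>i\<in>I. f i x)"
  by (induction I rule: infinite_finite_induct) simp_all

lemma maps_eq_sum_point_map:
  assumes "finite \<Omega>" "F \<in> maps \<Omega>"
  shows "F = (\<Sum>w\<in>\<Omega>. point_map w (F w))"
proof
  fix v
  have "(\<Sum>w\<in>\<Omega>. point_map w (F w) v) = (\<Sum>w\<in>\<Omega>. if v = w then F w else 0)"
    by (simp add: point_map_def)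
  then show "F v = (\<Sum>w\<in>\<Omega>. point_map w (F w)) v"
    using assms by (simp add: sum_fun_apply sum.delta' maps_def)
qed

lemma point_map_in_span:
  fixes C :: "'b::real_normed_vector set"
  assumes "span C = UNIV" "w \<in> \<Omega>"
  shows "point_map w x \<in> span ((\<lambda>(w, b). point_map w b) ` (\<Omega> \<times> C))" (is "_ \<in> span ?P")
proof -
  have "x \<in> span C" using assms(1) by simp
  then show ?thesis
  proof (induction rule: span_induct_alt)
    case base
    have "point_map w (0::'b) = 0" by (simp add: point_map_def fun_eq_iff)
    then show ?case by (metis span_zero)
  next
    case (step c b y)
    have "point_map w b \<in> span ?P" using assms(2) step(1) by (intro span_base) auto
    then show ?case
      unfolding point_map_add point_map_scaleR using step by (intro span_add span_scale)
  qed
qed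

text \<open>This supplies the finite spanning set over which the extension of a functional proceeds.\<close>

lemma maps_subset_span:
  fixes C :: "'b::real_normed_vector set"
  assumes "finite \<Omega>" "span C = UNIV"
  shows "(maps \<Omega> :: ('w \<Rightarrow> 'b) set) \<subseteq> span ((\<lambda>(w, b). point_map w b) ` (\<Omega> \<times> C))"
proof
  fix F :: "'w \<Rightarrow> 'b" assume "F \<in> maps \<Omega>"
  then have "F = (\<Sum>w\<in>\<Omega>. point_map w (F w))" by (rule maps_eq_sum_point_map[OF assms(1)])
  also have "\<dots> \<in> span ((\<lambda>(w, b). point_map w b) ` (\<Omega> \<times> C))"
    by (intro span_sum point_map_in_span assms(2))
  finally show "F \<in> span ((\<lambda>(w, b). point_map w b) ` (\<Omega> \<times> C))" .
qed

lemma conj_exponent_ge_1: "1 \<le> p \<Longrightarrow> 1 \<le> conj_exponent p"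
  by (auto simp: conj_exponent_def field_simps)

text \<open>After normalising both norms to \<open>1\<close>, Young's inequality applied pointwise sums up to \<open>1 / p + 1 / q = 1\<close>.\<close>

lemma Holder_pairing:
  assumes p: "1 \<le> p" and \<Omega>: "finite \<Omega>" "\<Omega> \<noteq> {}"
  shows "pairing \<Omega> u h \<le> Lnorm (ereal p) \<Omega> u * Lnorm (conj_exponent p) \<Omega> h"
proof -
  let ?N = "real (card \<Omega>)"
  have N: "?N > 0" using \<Omega> by (simp add: card_gt_0_iff)
  have p': "1 \<le> ereal p" using p by simp
  define a where "a = Lnorm (ereal p) \<Omega> u"
  define b where "b = Lnorm (conj_exponent p) \<Omega> h"
  have ab: "0 \<le> a" "0 \<le> b" using Lnorm_nonneg \<Omega> by (auto simp: a_def b_def)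
  have pt: "blinfun_apply (h w) (u w) \<le> norm (h w) * norm (u w)" for w
    using norm_blinfun[of "h w" "u w"] by simp
  show ?thesis
  proof (cases "p = 1")
    case True
    have "norm (h w) \<le> b" if "w \<in> \<Omega>" for w
      using that \<Omega> True by (simp add: b_def conj_exponent_def Lnorm_def)
    then have "(\<Sum>w\<in>\<Omega>. blinfun_apply (h w) (u w)) \<le> (\<Sum>w\<in>\<Omega>. b * norm (u w))"
      by (intro sum_mono order_trans[OF pt] mult_right_mono) auto
    also have "\<dots> = b * (a * ?N)"
      using N True by (simp add: a_def Lnorm_def sum_nonneg flip: sum_distrib_left)
    finally show ?thesis
      using N by (simp add: pairing_def a_def b_def divide_le_eq mult_ac)
  next
    case False
    then have p1: "p > 1" using p by simp
    define q where "q = p / (p - 1)"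
    have q: "q > 1" "1 / p + 1 / q = 1" "conj_exponent p = ereal q"
      using p1 by (auto simp: q_def field_simps conj_exponent_def)
    show ?thesis
    proof (cases "a = 0 \<or> b = 0")
      case True
      then have "blinfun_apply (h w) (u w) = 0" if "w \<in> \<Omega>" for w
        using that Lnorm_eq_0_iff[OF p' \<Omega>, of u] Lnorm_eq_0_iff[OF conj_exponent_ge_1[OF p] \<Omega>, of h]
        by (auto simp: a_def b_def)
      then show ?thesis using ab by (simp add: pairing_def a_def b_def)
    next
      case False
      then have pos: "0 < a" "0 < b" using ab by auto
      have A: "(\<Sum>w\<in>\<Omega>. norm (u w) powr p) = ?N * a powr p"
        using Lnorm_powr[OF p \<Omega>, of u] N by (simp add: a_def)
      have B: "(\<Sum>w\<in>\<Omega>. norm (h w) powr q) = ?N * b powr q"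
        using Lnorm_powr[OF _ \<Omega>, of q h] N q by (simp add: b_def)
      have "norm (h w) * norm (u w)
          \<le> a * b * (norm (u w) powr p / (p * a powr p) + norm (h w) powr q / (q * b powr q))" for w
      proof -
        have "(norm (u w) / a) * (norm (h w) / b)
            \<le> (norm (u w) / a) powr p / p + (norm (h w) / b) powr q / q"
          using pos p1 q by (intro Youngs_inequality) auto
        then have "a * b * ((norm (u w) / a) * (norm (h w) / b))
            \<le> a * b * ((norm (u w) / a) powr p / p + (norm (h w) / b) powr q / q)"
          using pos by (intro mult_left_mono) auto
        then show ?thesis using pos by (simp add: powr_divide mult_ac)
      qed
      then have "(\<Sum>w\<in>\<Omega>. blinfun_apply (h w) (u w)) \<le>
          (\<Sum>w\<in>\<Omega>. a * b * (norm (u w) powr p / (p * a powr p) + norm (h w) powr q / (q * b powr q)))"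
        by (intro sum_mono order_trans[OF pt])
      also have "\<dots> = a * b * ((\<Sum>w\<in>\<Omega>. norm (u w) powr p) / (p * a powr p)
          + (\<Sum>w\<in>\<Omega>. norm (h w) powr q) / (q * b powr q))"
        by (simp add: sum.distrib sum_divide_distrib flip: sum_distrib_left)
      also have "\<dots> = a * b * (?N * (1 / p + 1 / q))"
        unfolding A B using pos by (simp add: distrib_left)
      also have "\<dots> = a * b * ?N" using q(2) by simp
      finally show ?thesis using N by (simp add: pairing_def a_def b_def divide_le_eq)
    qed
  qed
qed

text \<open>The supremum of the functional over the unit ball is attained by compactness.\<close>

lemma norming_vector_exists:
  fixes C :: "'a::real_normed_vector set" and f :: "'a \<Rightarrow>\<^sub>L real"
  assumes "finite C" "span C = UNIV"
  obtains x where "norm x \<le> 1" "blinfun_apply f x = norm f"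
proof -
  have ne: "cball (0::'a) 1 \<noteq> {}" by simp
  have "continuous_on (cball 0 1) (blinfun_apply f)"
    by (intro linear_continuous_on blinfun.bounded_linear_right)
  then obtain x where x: "x \<in> cball 0 1" "\<And>y. y \<in> cball 0 1 \<Longrightarrow> blinfun_apply f y \<le> blinfun_apply f x"
    using continuous_attains_sup[OF compact_cball_finite_dim[OF assms] ne] by metis
  have nonneg: "0 \<le> blinfun_apply f x" using x(2)[of 0] by simp
  have le: "blinfun_apply f y \<le> blinfun_apply f x * norm y" for y
  proof (cases "y = 0")
    case False
    have "blinfun_apply f ((1 / norm y) *\<^sub>R y) \<le> blinfun_apply f x"
      using False by (intro x(2)) simp
    then show ?thesis using False by (simp add: blinfun.scaleR_right divide_le_eq)
  qed simp
  have "norm (blinfun_apply f y) \<le> blinfun_apply f x * norm y" for y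
    using le[of y] le[of "- y"] by (simp add: blinfun.minus_right abs_le_iff)
  then have "norm f \<le> blinfun_apply f x" by (intro norm_blinfun_bound nonneg)
  moreover have "blinfun_apply f x \<le> norm f"
    using norm_blinfun[of f x] x(1) mult_left_mono[of "norm x" 1 "norm f"] by simp
  ultimately show ?thesis using x(1) by (intro that) auto
qed

text \<open>The converse of Hoelder's inequality. With norming vectors \<open>x\<^sub>w\<close> for \<open>h w\<close>, the extremal test map is a
  multiple of \<open>x\<^sub>w\<close> concentrated at one point if \<open>p = 1\<close>, and \<open>w \<mapsto> norm (h w)\<^bsup>q - 1\<^esup> x\<^sub>w\<close> with \<open>q = p / (p - 1)\<close> otherwise.\<close>

lemma Lnorm_conj_le_if_pairing_le:
  fixes C :: "'a::real_normed_vector set" and h :: "'w \<Rightarrow> 'a \<Rightarrow>\<^sub>L real"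
  assumes p: "1 \<le> p" and \<Omega>: "finite \<Omega>" "\<Omega> \<noteq> {}" and C: "finite C" "span C = UNIV"
    and c: "0 \<le> c"
    and le: "\<And>u. u \<in> maps \<Omega> \<Longrightarrow> pairing \<Omega> u h \<le> c * Lnorm (ereal p) \<Omega> u"
  shows "Lnorm (conj_exponent p) \<Omega> h \<le> c"
proof -
  let ?N = "real (card \<Omega>)"
  have N: "?N > 0" using \<Omega> by (simp add: card_gt_0_iff)
  have "\<exists>x. norm x \<le> 1 \<and> blinfun_apply (h w) x = norm (h w)" for w
    using norming_vector_exists[OF C] by metis
  then obtain x where x: "\<And>w. norm (x w) \<le> 1" "\<And>w. blinfun_apply (h w) (x w) = norm (h w)"
    by metis
  show ?thesis
  proof (cases "p = 1")
    case True
    have "norm (h w) \<le> c" if w: "w \<in> \<Omega>" for w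
    proof -
      have "(\<Sum>v\<in>\<Omega>. blinfun_apply (h v) (point_map w (x w) v)) = (\<Sum>v\<in>\<Omega>. if v = w then norm (h w) else 0)"
        by (intro sum.cong) (auto simp: x point_map_def)
      then have 1: "pairing \<Omega> (point_map w (x w)) h = norm (h w) / ?N"
        using w \<Omega> by (simp add: pairing_def)
      have "(\<Sum>v\<in>\<Omega>. norm (point_map w (x w) v)) = (\<Sum>v\<in>\<Omega>. if v = w then norm (x w) else 0)"
        by (intro sum.cong) (auto simp: point_map_def)
      then have "Lnorm (ereal p) \<Omega> (point_map w (x w)) = norm (x w) / ?N"
        using w \<Omega> True by (simp add: Lnorm_def)
      also have "\<dots> \<le> 1 / ?N" using x(1) N by (intro divide_right_mono) auto
      finally have "norm (h w) / ?N \<le> c * (1 / ?N)"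
        using le[OF point_map_in_maps[OF w], of "x w"] c unfolding 1 by (meson mult_left_mono order_trans)
      then show ?thesis using N by (simp add: field_simps)
    qed
    then show ?thesis using True \<Omega> by (simp add: Lnorm_def conj_exponent_def)
  next
    case False
    then have p1: "p > 1" using p by simp
    define q where "q = p / (p - 1)"
    \<comment> \<open>The two relations between \<open>p\<close> and \<open>q\<close> turn \<open>b\<^sup>q \<le> c b\<^bsup>q / p\<^esup>\<close> into \<open>b \<le> c\<close>.\<close>
    have "q - q / p = (p - 1) / (p - 1)"
      using p1 unfolding q_def diff_divide_distrib by simp
    then have q: "q > 1" "(q - 1) * p = q" "q - q / p = 1" "conj_exponent p = ereal q"
      using p1 by (auto simp: q_def field_simps conj_exponent_def)
    define b where "b = Lnorm (ereal q) \<Omega> h"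
    have B: "(\<Sum>w\<in>\<Omega>. norm (h w) powr q) / ?N = b powr q"
      using Lnorm_powr[OF _ \<Omega>, of q h] q by (simp add: b_def)
    define u where "u = (\<lambda>w. if w \<in> \<Omega> then (norm (h w) powr (q - 1)) *\<^sub>R x w else 0)"
    have "(\<Sum>w\<in>\<Omega>. blinfun_apply (h w) (u w)) = (\<Sum>w\<in>\<Omega>. norm (h w) powr q)"
    proof (intro sum.cong refl)
      fix w assume "w \<in> \<Omega>"
      then have "blinfun_apply (h w) (u w) = norm (h w) powr (q - 1) * norm (h w)"
        by (simp add: u_def blinfun.scaleR_right x)
      also have "\<dots> = norm (h w) powr (q - 1) * norm (h w) powr 1" by simp
      also have "\<dots> = norm (h w) powr ((q - 1) + 1)" by (rule powr_add[symmetric])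
      also have "\<dots> = norm (h w) powr q" by simp
      finally show "blinfun_apply (h w) (u w) = norm (h w) powr q" .
    qed
    then have pair: "pairing \<Omega> u h = b powr q" by (simp add: pairing_def B)
    have "norm (u w) powr p \<le> norm (h w) powr q" if "w \<in> \<Omega>" for w
    proof -
      have "norm (u w) \<le> norm (h w) powr (q - 1) * 1"
        using that mult_left_mono[OF x(1)[of w], of "norm (h w) powr (q - 1)"] by (simp add: u_def)
      then have "norm (u w) powr p \<le> (norm (h w) powr (q - 1)) powr p"
        using p1 by (intro powr_mono2) auto
      then show ?thesis by (simp add: powr_powr q)
    qed
    then have "(\<Sum>w\<in>\<Omega>. norm (u w) powr p) / ?N \<le> b powr q"
      unfolding B[symmetric] by (intro divide_right_mono sum_mono) auto
    then have "((\<Sum>w\<in>\<Omega>. norm (u w) powr p) / ?N) powr (1 / p) \<le> (b powr q) powr (1 / p)"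
      using p1 by (intro powr_mono2) (auto intro!: divide_nonneg_nonneg sum_nonneg)
    then have "Lnorm (ereal p) \<Omega> u \<le> b powr (q / p)"
      by (simp add: Lnorm_def powr_powr)
    moreover have "u \<in> maps \<Omega>" by (simp add: u_def maps_def)
    ultimately have main: "b powr q \<le> c * b powr (q / p)"
      using le[of u] c unfolding pair by (meson mult_left_mono order_trans)
    show ?thesis
    proof (cases "b = 0")
      case False
      then have b: "b > 0" using Lnorm_nonneg[OF \<Omega>, of "ereal q" h] by (simp add: b_def)
      have "b powr q = b powr (q / p) * b powr (q - q / p)" by (simp flip: powr_add)
      also have "b powr (q - q / p) = b" using b by (simp add: q)
      finally have "b powr (q / p) * b \<le> b powr (q / p) * c" using main by (simp add: mult.commute)
      then show ?thesis using b by (simp add: q b_def)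
    qed (use c q in \<open>simp add: b_def\<close>)
  qed
qed

text \<open>The value \<open>h w\<close> is the functional \<open>x \<mapsto> card \<Omega> * l(point_map w x)\<close>; the factor undoes the
  normalisation of the pairing.\<close>

lemma functional_on_maps_representation:
  fixes l :: "('w \<Rightarrow> 'a::real_normed_vector) \<Rightarrow> real" and C :: "'a set"
  assumes p: "1 \<le> p" and \<Omega>: "finite \<Omega>" "\<Omega> \<noteq> {}" and C: "finite C" "span C = UNIV"
    and c: "0 \<le> c"
    and add: "\<And>u v. u \<in> maps \<Omega> \<Longrightarrow> v \<in> maps \<Omega> \<Longrightarrow> l (u + v) = l u + l v"
    and scale: "\<And>t u. u \<in> maps \<Omega> \<Longrightarrow> l (t *\<^sub>R u) = t * l u"
    and le: "\<And>u. u \<in> maps \<Omega> \<Longrightarrow> l u \<le> c * Lnorm (ereal p) \<Omega> u"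
  obtains h where "h \<in> maps \<Omega>" "\<And>u. u \<in> maps \<Omega> \<Longrightarrow> pairing \<Omega> u h = l u"
    "Lnorm (conj_exponent p) \<Omega> h \<le> c"
proof -
  let ?N = "real (card \<Omega>)"
  have N: "?N > 0" using \<Omega> by (simp add: card_gt_0_iff)
  have p': "1 \<le> ereal p" using p by simp
  note pm = point_map_in_maps
  have bl: "bounded_linear (\<lambda>x. l (point_map w x))" if w: "w \<in> \<Omega>" for w
  proof (rule bounded_linear_intro[of _ "c * Lnorm (ereal p) \<Omega> (\<lambda>v. if v = w then 1 else 0 :: real)"])
    show "l (point_map w (x + y)) = l (point_map w x) + l (point_map w y)" for x y
      by (simp only: point_map_add add[OF pm[OF w] pm[OF w]])
    show "l (point_map w (t *\<^sub>R x)) = t *\<^sub>R l (point_map w x)" for t x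
      by (simp only: point_map_scaleR scale[OF pm[OF w]] real_scaleR_def)
    fix x :: 'a
    let ?d = "\<lambda>v. if v = w then 1 else 0 :: real"
    have eq: "Lnorm (ereal p) \<Omega> (point_map w x) = Lnorm (ereal p) \<Omega> ?d * norm x"
    proof -
      have "Lnorm (ereal p) \<Omega> (point_map w x) = Lnorm (ereal p) \<Omega> (norm x *\<^sub>R ?d)"
        unfolding Lnorm_def by (auto simp: point_map_def intro!: sum.cong arg_cong2[of _ _ _ _ "(powr)"] arg_cong2[of _ _ _ _ "(/)"])
      then show ?thesis using Lnorm_scaleR[OF p' \<Omega>, of "norm x" ?d] by (simp add: mult.commute)
    qed
    have "l (point_map w x) \<le> c * Lnorm (ereal p) \<Omega> (point_map w x)" by (rule le[OF pm[OF w]])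
    moreover have "- l (point_map w x) \<le> c * Lnorm (ereal p) \<Omega> (point_map w x)"
    proof -
      have "- l (point_map w x) = l (- point_map w x)" using scale[OF pm[OF w], of "- 1" x] by simp
      also have "\<dots> \<le> c * Lnorm (ereal p) \<Omega> (- point_map w x)"
        using subspace_neg[OF subspace_maps pm[OF w]] by (rule le)
      finally show ?thesis by (simp only: Lnorm_minus[OF p' \<Omega>])
    qed
    ultimately show "norm (l (point_map w x)) \<le> norm x * (c * Lnorm (ereal p) \<Omega> ?d)"
      unfolding eq by (simp add: abs_le_iff mult_ac)
  qed
  define h where "h = (\<lambda>w. if w \<in> \<Omega> then ?N *\<^sub>R Blinfun (\<lambda>x. l (point_map w x)) else 0)"
  have h: "h \<in> maps \<Omega>" by (simp add: h_def maps_def)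
  have sum: "l (\<Sum>w\<in>S. point_map w (u w)) = (\<Sum>w\<in>S. l (point_map w (u w)))" if "S \<subseteq> \<Omega>" for S u
    using finite_subset[OF that \<Omega>(1)] that
  proof (induction S rule: finite_induct)
    case empty
    have "l 0 = 0" using scale[OF subspace_0[OF subspace_maps], of 0] by simp
    then show ?case unfolding sum.empty .
  next
    case (insert w S)
    have "(\<Sum>w\<in>S. point_map w (u w)) \<in> maps \<Omega>"
      using insert.prems by (intro subspace_sum[OF subspace_maps] pm) auto
    then show ?case
      using insert unfolding sum.insert[OF insert(1,2)] by (subst add) (auto intro: pm)
  qed
  have pair: "pairing \<Omega> u h = l u" if u: "u \<in> maps \<Omega>" for u
  proof -
    have "(\<Sum>w\<in>\<Omega>. blinfun_apply (h w) (u w)) = (\<Sum>w\<in>\<Omega>. ?N * l (point_map w (u w)))"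
      by (intro sum.cong) (auto simp: h_def blinfun.scaleR_left bounded_linear_Blinfun_apply bl)
    also have "\<dots> = ?N * l (\<Sum>w\<in>\<Omega>. point_map w (u w))"
      by (simp only: sum[OF subset_refl] sum_distrib_left)
    also have "(\<Sum>w\<in>\<Omega>. point_map w (u w)) = u"
      by (rule maps_eq_sum_point_map[OF \<Omega>(1) u, symmetric])
    finally show ?thesis using N by (simp add: pairing_def)
  qed
  moreover have "Lnorm (conj_exponent p) \<Omega> h \<le> c"
    by (rule Lnorm_conj_le_if_pairing_le[OF p \<Omega> C c]) (use pair le in simp)
  ultimately show ?thesis using h by (intro that)
qed

text \<open>The quantitative duality principle behind the theorem: an estimate of \<open>D\<^sub>1 F\<close> by \<open>D\<^sub>2 F\<close> lets the adjoint
  equation \<open>D\<^sub>2\<^sup>* h = D\<^sub>1\<^sup>* g\<close> be solved with the same constant. By Hoelder, \<open>D\<^sub>2 F \<mapsto> \<langle>D\<^sub>1 F, g\<rangle>\<close> is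
  a functional on the range of \<open>D\<^sub>2\<close> of norm at most \<open>K\<close> times the norm of \<open>g\<close>; its Hahn--Banach extension is represented by \<open>h\<close>.\<close>

theorem adjoint_solution_exists:
  fixes D1 :: "('s \<Rightarrow> 'a::real_normed_vector) \<Rightarrow> 'v \<Rightarrow> 'a" and D2 :: "('s \<Rightarrow> 'a) \<Rightarrow> 'w \<Rightarrow> 'a"
    and C :: "'a set"
  assumes p: "1 \<le> p" and \<Omega>1: "finite \<Omega>1" "\<Omega>1 \<noteq> {}" and \<Omega>2: "finite \<Omega>2" "\<Omega>2 \<noteq> {}"
    and C: "finite C" "span C = UNIV" and V: "subspace V"
    and D1: "\<And>F H. D1 (F + H) = D1 F + D1 H" "\<And>t F. D1 (t *\<^sub>R F) = t *\<^sub>R D1 F"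
    and D2: "\<And>F H. D2 (F + H) = D2 F + D2 H" "\<And>t F. D2 (t *\<^sub>R F) = t *\<^sub>R D2 F"
      "\<And>F. D2 F \<in> maps \<Omega>2"
    and K: "0 \<le> K" "\<And>F. F \<in> V \<Longrightarrow> Lnorm (ereal p) \<Omega>1 (D1 F) \<le> K * Lnorm (ereal p) \<Omega>2 (D2 F)"
  obtains h where "h \<in> maps \<Omega>2" "\<And>F. F \<in> V \<Longrightarrow> pairing \<Omega>2 (D2 F) h = pairing \<Omega>1 (D1 F) g"
    "Lnorm (conj_exponent p) \<Omega>2 h \<le> K * Lnorm (conj_exponent p) \<Omega>1 g"
proof -
  have p': "1 \<le> ereal p" using p by simp
  define b where "b = Lnorm (conj_exponent p) \<Omega>1 g"
  have b: "0 \<le> b" using Lnorm_nonneg[OF \<Omega>1] by (simp add: b_def)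
  define q where "q = (\<lambda>u :: 'w \<Rightarrow> 'a. K * b * Lnorm (ereal p) \<Omega>2 u)"
  have Kb: "0 \<le> K * b" using K b by simp
  have q: "sublinear q"
    unfolding sublinear_def
  proof (intro conjI allI impI)
    show "q (u + v) \<le> q u + q v" for u v
      using mult_left_mono[OF Lnorm_add_le[OF p' \<Omega>2, of u v] Kb] by (simp add: q_def distrib_left)
    show "q (t *\<^sub>R u) = t * q u" if "0 \<le> t" for t u
      using that Lnorm_scaleR[OF p' \<Omega>2, of t u] by (simp add: q_def)
  qed
  define R where "R = (\<lambda>F. (D2 F, pairing \<Omega>1 (D1 F) g)) ` V"
  have pair_add: "pairing \<Omega>1 (u + v) g = pairing \<Omega>1 u g + pairing \<Omega>1 v g" for u v
    by (simp add: pairing_def blinfun.add_right sum.distrib add_divide_distrib)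
  have pair_scale: "pairing \<Omega>1 (t *\<^sub>R u) g = t * pairing \<Omega>1 u g" for t u
    by (simp add: pairing_def blinfun.scaleR_right flip: sum_distrib_left)
  define B where "B = (\<lambda>(w, b). point_map w b) ` (\<Omega>2 \<times> C)"
  have B: "finite B" "maps \<Omega>2 \<subseteq> span B"
    using \<Omega>2(1) C(1) maps_subset_span[OF \<Omega>2(1) C(2)] by (auto simp: B_def)
  obtain l where l: "\<And>u. l u \<le> q u" "\<And>v s. (v, s) \<in> R \<Longrightarrow> v \<in> span B \<Longrightarrow> l v = s"
    "\<And>u v. u \<in> span B \<Longrightarrow> v \<in> span B \<Longrightarrow> l (u + v) = l u + l v"
    "\<And>t u. u \<in> span B \<Longrightarrow> l (t *\<^sub>R u) = t * l u"
  proof (rule dominated_functional_exists[OF q, of R B])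
    show "(0, 0) \<in> R"
    proof -
      have "D2 0 = 0" "pairing \<Omega>1 (D1 0) g = 0"
        using D2(2)[of 0 0] D1(2)[of 0 0] pair_scale[of 0 "D1 0"] by simp_all
      then show ?thesis unfolding R_def using subspace_0[OF V] by (metis (no_types, lifting) image_eqI)
    qed
    show "(v + v', s + s') \<in> R" if R: "(v, s) \<in> R" "(v', s') \<in> R" for v s v' s'
    proof -
      obtain F H where "F \<in> V" "v = D2 F" "s = pairing \<Omega>1 (D1 F) g"
        "H \<in> V" "v' = D2 H" "s' = pairing \<Omega>1 (D1 H) g" using R by (auto simp: R_def)
      then show ?thesis
        unfolding R_def using subspace_add[OF V, of F H]
        by (intro image_eqI[of _ _ "F + H"]) (auto simp: D1 D2 pair_add)
    qed
    show "(t *\<^sub>R v, t * s) \<in> R" if R: "(v, s) \<in> R" for v s t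
    proof -
      obtain F where "F \<in> V" "v = D2 F" "s = pairing \<Omega>1 (D1 F) g" using R by (auto simp: R_def)
      then show ?thesis
        unfolding R_def using subspace_scale[OF V, of F t]
        by (intro image_eqI[of _ _ "t *\<^sub>R F"]) (auto simp: D1 D2 pair_scale)
    qed
    show "s \<le> q v" if R: "(v, s) \<in> R" for v s
    proof -
      obtain F where F: "F \<in> V" "v = D2 F" "s = pairing \<Omega>1 (D1 F) g" using R by (auto simp: R_def)
      have "s \<le> Lnorm (ereal p) \<Omega>1 (D1 F) * b"
        unfolding F b_def by (rule Holder_pairing[OF p \<Omega>1])
      also have "\<dots> \<le> (K * Lnorm (ereal p) \<Omega>2 (D2 F)) * b"
        by (intro mult_right_mono K F b)
      finally show ?thesis by (simp add: q_def F mult_ac)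
    qed
  qed (use B in auto)
  obtain h where h: "h \<in> maps \<Omega>2" "\<And>u. u \<in> maps \<Omega>2 \<Longrightarrow> pairing \<Omega>2 u h = l u"
    "Lnorm (conj_exponent p) \<Omega>2 h \<le> K * b"
  proof (rule functional_on_maps_representation[OF p \<Omega>2 C Kb, of l])
    show "l (u + v) = l u + l v" if "u \<in> maps \<Omega>2" "v \<in> maps \<Omega>2" for u v
      using that B by (intro l) auto
    show "l (t *\<^sub>R u) = t * l u" if "u \<in> maps \<Omega>2" for t u
      using that B by (intro l) auto
    show "l u \<le> K * b * Lnorm (ereal p) \<Omega>2 u" for u using l(1)[of u] by (simp add: q_def)
  qed auto
  have "pairing \<Omega>2 (D2 F) h = pairing \<Omega>1 (D1 F) g" if F: "F \<in> V" for F
    using h(2)[OF D2(3)] l(2)[of "D2 F" "pairing \<Omega>1 (D1 F) g"] F B(2) D2(3) by (auto simp: R_def)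
  then show ?thesis using h by (intro that) (auto simp: b_def)
qed

section \<open>The difference operators and their adjoints\<close>

lemma finite_G: "finite (G m n)"
  by (simp add: G_def finite_PiE)

lemma G_nonempty: "1 \<le> m \<Longrightarrow> G m n \<noteq> {}"
  by (simp add: G_def PiE_eq_empty_iff)

lemma finite_signs: "finite (signs n)"
  by (simp add: signs_def finite_PiE)

lemma card_signs: "card (signs n) = 2 ^ n"
  by (simp add: signs_def card_PiE numeral_2_eq_2)

lemma signs_nonempty: "signs n \<noteq> {}"
  by (simp add: signs_def PiE_eq_empty_iff)

lemma translate_in_G: "1 \<le> m \<Longrightarrow> translate m n x v \<in> G m n"
  by (auto simp: translate_def G_def)

lemma translate_inverse:
  assumes "x \<in> G m n"
  shows "translate m n (translate m n x v) (\<lambda>i. - v i) = x"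
    and "translate m n (translate m n x (\<lambda>i. - v i)) v = x"
proof -
  have x: "x \<in> extensional {1..n}" "\<And>i. i \<in> {1..n} \<Longrightarrow> x i mod (2 * int m) = x i"
    using assms by (auto simp: G_def PiE_iff)
  show "translate m n (translate m n x v) (\<lambda>i. - v i) = x"
    by (rule extensionalityI[OF _ x(1)]) (auto simp: translate_def mod_simps x(2))
  show "translate m n (translate m n x (\<lambda>i. - v i)) v = x"
    by (rule extensionalityI[OF _ x(1)]) (auto simp: translate_def mod_simps x(2))
qed

lemma sum_translate:
  assumes "1 \<le> m"
  shows "(\<Sum>x\<in>G m n. f (translate m n x v) x) = (\<Sum>x\<in>G m n. f x (translate m n x (\<lambda>i. - v i)))"
  by (rule sum.reindex_bij_witness[where i = "\<lambda>x. translate m n x (\<lambda>i. - v i)" and j = "\<lambda>x. translate m n x v"])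
    (auto simp: translate_inverse translate_in_G[OF assms])

text \<open>Both difference operators have this form, with the shifts \<open>v j = m e\<^sub>j\<close> and \<open>v \<epsilon> = \<epsilon>\<close>. The
  translations are bijections of the group, so a shift moves from \<open>F\<close> to \<open>h\<close> with the opposite sign.\<close>

lemma summation_by_parts:
  fixes F :: "(nat \<Rightarrow> int) \<Rightarrow> 'a::real_normed_vector" and h :: "(nat \<Rightarrow> int) \<times> 'j \<Rightarrow> 'a \<Rightarrow>\<^sub>L real"
  assumes "1 \<le> m"
  shows "(\<Sum>(x, j)\<in>G m n \<times> J. blinfun_apply (h (x, j)) (F (translate m n x (v j)) - F x)) =
    (\<Sum>x\<in>G m n. blinfun_apply (\<Sum>j\<in>J. h (translate m n x (\<lambda>i. - v j i), j) - h (x, j)) (F x))"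
proof -
  have "(\<Sum>(x, j)\<in>G m n \<times> J. blinfun_apply (h (x, j)) (F (translate m n x (v j)) - F x)) =
      (\<Sum>j\<in>J. (\<Sum>x\<in>G m n. blinfun_apply (h (x, j)) (F (translate m n x (v j))))
        - (\<Sum>x\<in>G m n. blinfun_apply (h (x, j)) (F x)))"
    unfolding sum.cartesian_product[symmetric]
    by (subst sum.swap) (simp add: blinfun.diff_right sum_subtractf)
  also have "\<dots> = (\<Sum>j\<in>J. (\<Sum>x\<in>G m n. blinfun_apply (h (translate m n x (\<lambda>i. - v j i), j)) (F x))
        - (\<Sum>x\<in>G m n. blinfun_apply (h (x, j)) (F x)))"
    by (simp only: sum_translate[OF assms, where f = "\<lambda>y x. blinfun_apply (h (x, j)) (F y)" for j])
  also have "\<dots> = (\<Sum>x\<in>G m n. blinfun_apply (\<Sum>j\<in>J. h (translate m n x (\<lambda>i. - v j i), j) - h (x, j)) (F x))"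
    by (simp add: blinfun.sum_left blinfun.diff_left sum_subtractf sum.swap[where A = J and B = "G m n"])
  finally show ?thesis .
qed

lemma pairing_D_long:
  assumes "1 \<le> m"
  shows "pairing (G m n \<times> {1..n}) (D_long m n F) g = pairing (G m n) F (D_long_adj m n g)"
proof -
  let ?v = "\<lambda>j i. int m * basis_vec j i"
  have "(\<Sum>w\<in>G m n \<times> {1..n}. blinfun_apply (g w) (D_long m n F w)) =
      (\<Sum>(x, j)\<in>G m n \<times> {1..n}. blinfun_apply (g (x, j)) (F (translate m n x (?v j)) - F x))"
    by (intro sum.cong) (auto simp: D_long_def)
  also have "\<dots> = (\<Sum>x\<in>G m n. blinfun_apply
      (\<Sum>j\<in>{1..n}. g (translate m n x (\<lambda>i. - ?v j i), j) - g (x, j)) (F x))"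
    by (rule summation_by_parts[OF assms])
  finally show ?thesis
    unfolding pairing_def
    by (simp add: D_long_adj_def blinfun.scaleR_left card_cartesian_product mult.commute flip: sum_divide_distrib)
qed

lemma pairing_D_sgn:
  assumes "1 \<le> m"
  shows "pairing (G m n \<times> signs n) (D_sgn m n F) h = pairing (G m n) F (D_sgn_adj m n h)"
proof -
  have "(\<Sum>w\<in>G m n \<times> signs n. blinfun_apply (h w) (D_sgn m n F w)) =
      (\<Sum>(x, e)\<in>G m n \<times> signs n. blinfun_apply (h (x, e)) (F (translate m n x (\<lambda>i. e i)) - F x))"
    by (intro sum.cong) (auto simp: D_sgn_def)
  also have "\<dots> = (\<Sum>x\<in>G m n. blinfun_apply
      (\<Sum>e\<in>signs n. h (translate m n x (\<lambda>i. - e i), e) - h (x, e)) (F x))"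
    by (rule summation_by_parts[OF assms])
  finally show ?thesis
    unfolding pairing_def
    by (simp add: D_sgn_adj_def blinfun.scaleR_left card_cartesian_product card_signs mult.commute flip: sum_divide_distrib)
qed

text \<open>Maps supported at one point suffice as test maps.\<close>

lemma pairing_separates:
  assumes "finite \<Omega>" "k \<in> maps \<Omega>" "k' \<in> maps \<Omega>"
    and eq: "\<And>F. F \<in> maps \<Omega> \<Longrightarrow> pairing \<Omega> F k = pairing \<Omega> F k'"
  shows "k = k'"
proof
  fix w
  show "k w = k' w"
  proof (cases "w \<in> \<Omega>")
    case True
    have at_point: "pairing \<Omega> (point_map w y) k = blinfun_apply (k w) y / real (card \<Omega>)" for k y
    proof -
      have "(\<Sum>v\<in>\<Omega>. blinfun_apply (k v) (point_map w y v)) = (\<Sum>v\<in>\<Omega>. if v = w then blinfun_apply (k w) y else 0)"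
        by (intro sum.cong) (auto simp: point_map_def)
      then show ?thesis using True assms(1) by (simp add: pairing_def)
    qed
    have "card \<Omega> \<noteq> 0" using True assms(1) by auto
    then show ?thesis
      using eq[OF point_map_in_maps[OF True]] by (intro blinfun_eqI) (simp add: at_point)
  qed (use assms in \<open>simp add: maps_def\<close>)
qed

lemma D_long_linear:
  "D_long m n (F + H) = D_long m n F + D_long m n H"
  "D_long m n (t *\<^sub>R F) = t *\<^sub>R D_long m n F"
  by (auto simp: D_long_def fun_eq_iff scaleR_diff_right)

lemma D_sgn_linear:
  "D_sgn m n (F + H) = D_sgn m n F + D_sgn m n H"
  "D_sgn m n (t *\<^sub>R F) = t *\<^sub>R D_sgn m n F"
  by (auto simp: D_sgn_def fun_eq_iff scaleR_diff_right)

lemma D_long_adj_linear: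
  "D_long_adj m n (g + g') = D_long_adj m n g + D_long_adj m n g'"
  "D_long_adj m n (t *\<^sub>R g) = t *\<^sub>R D_long_adj m n g"
  by (auto simp: D_long_adj_def fun_eq_iff add_diff_add sum.distrib scaleR_add_right mult.commute
      simp flip: scaleR_sum_right scaleR_diff_right)

lemma D_sgn_adj_linear:
  "D_sgn_adj m n (h + h') = D_sgn_adj m n h + D_sgn_adj m n h'"
  "D_sgn_adj m n (t *\<^sub>R h) = t *\<^sub>R D_sgn_adj m n h"
  by (auto simp: D_sgn_adj_def fun_eq_iff add_diff_add sum.distrib scaleR_add_right mult.commute
      simp flip: scaleR_sum_right scaleR_diff_right)

lemma fibre_add: "h \<in> fibre m n g \<Longrightarrow> h' \<in> fibre m n g' \<Longrightarrow> h + h' \<in> fibre m n (g + g')"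
  by (simp add: fibre_def D_long_adj_linear D_sgn_adj_linear subspace_add[OF subspace_maps])

lemma fibre_scaleR: "h \<in> fibre m n g \<Longrightarrow> t *\<^sub>R h \<in> fibre m n (t *\<^sub>R g)"
  by (simp add: fibre_def D_long_adj_linear D_sgn_adj_linear subspace_scale[OF subspace_maps])

lemma fibre_zero: "0 \<in> fibre m n 0"
proof -
  have "D_sgn_adj m n 0 = D_long_adj m n 0"
    by (simp add: D_sgn_adj_def D_long_adj_def fun_eq_iff)
  then show ?thesis by (simp add: fibre_def subspace_0[OF subspace_maps])
qed

text \<open>The adjoint at \<open>x\<close> is a linear combination of finitely many values of \<open>h\<close>, hence continuous for pointwise convergence.\<close>

lemma closed_fibre: "closed (fibre m n g)"
proof -
  have "continuous_on UNIV (\<lambda>h. D_sgn_adj m n h x)" for x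
    unfolding D_sgn_adj_def
    by (cases "x \<in> G m n") (auto intro!: continuous_intros continuous_on_product_coordinates)
  then have "closed {h. D_sgn_adj m n h x = D_long_adj m n g x}" for x
    by (rule closed_level_set)
  then have "closed (maps (G m n \<times> signs n) \<inter> (\<Inter>x. {h. D_sgn_adj m n h x = D_long_adj m n g x}))"
    by (intro closed_Int closed_maps closed_INT) auto
  also have "maps (G m n \<times> signs n) \<inter> (\<Inter>x. {h. D_sgn_adj m n h x = D_long_adj m n g x}) = fibre m n g"
    by (auto simp: fibre_def fun_eq_iff)
  finally show ?thesis .
qed

text \<open>If \<open>D\<^sub>s\<^sub>g\<^sub>n F = 0\<close>, the ratio in the definition of the constant says nothing; there the inclusion of kernels,
  which is part of finiteness of the constant, makes the left-hand side vanish.\<close>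

lemma Lnorm_D_long_le:
  fixes F :: "(nat \<Rightarrow> int) \<Rightarrow> 'a::real_normed_vector"
  assumes p: "1 \<le> p" and n: "1 \<le> n" and m: "1 \<le> m" and C: "C_const TYPE('a) p n m < \<infinity>"
    and F: "F \<in> maps (G m n)"
  shows "Lnorm (ereal p) (G m n \<times> {1..n}) (D_long m n F) \<le>
    enn2real (C_const TYPE('a) p n m) * Lnorm (ereal p) (G m n \<times> signs n) (D_sgn m n F)"
proof -
  let ?L = "Lnorm (ereal p) (G m n \<times> {1..n}) (D_long m n F)"
  let ?S = "Lnorm (ereal p) (G m n \<times> signs n) (D_sgn m n F)"
  let ?A = "{F \<in> maps (G m n). D_sgn m n F \<noteq> (\<lambda>_. 0 :: 'a)}"
  have p': "1 \<le> ereal p" using p by simp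
  have fin: "finite (G m n \<times> {1..n})" "G m n \<times> {1..n} \<noteq> {}"
    "finite (G m n \<times> signs n)" "G m n \<times> signs n \<noteq> {}"
    using n m by (simp_all add: finite_G finite_signs G_nonempty signs_nonempty)
  have ker: "{F \<in> maps (G m n). D_sgn m n F = (\<lambda>_. 0 :: 'a)} \<subseteq> {F \<in> maps (G m n). D_long m n F = (\<lambda>_. 0)}"
    using C by (auto simp: C_const_def split: if_splits)
  show ?thesis
  proof (cases "D_sgn m n F = (\<lambda>_. 0)")
    case True
    then have "D_long m n F = (\<lambda>_. 0)" using ker F by blast
    then have "?L = 0" using Lnorm_eq_0_iff[OF p' fin(1,2), of "D_long m n F"] by simp
    moreover have "0 \<le> ?S" by (rule Lnorm_nonneg[OF fin(3,4)])
    ultimately show ?thesis by simp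
  next
    case False
    have "?S \<noteq> 0"
    proof
      assume "?S = 0"
      then have "D_sgn m n F w = 0" for w
        using Lnorm_eq_0_iff[OF p' fin(3,4), of "D_sgn m n F"]
        by (cases w, cases "w \<in> G m n \<times> signs n") (auto simp: D_sgn_def)
      then show False using False by (simp add: fun_eq_iff)
    qed
    then have S: "?S > 0" using Lnorm_nonneg[OF fin(3,4), of "ereal p" "D_sgn m n F"] by linarith
    have eq: "C_const TYPE('a) p n m = (SUP F\<in>?A. ennreal (Lnorm (ereal p) (G m n \<times> {1..n}) (D_long m n F) /
        Lnorm (ereal p) (G m n \<times> signs n) (D_sgn m n F)))"
      unfolding C_const_def using ker by (rule if_P)
    have "ennreal (?L / ?S) \<le> C_const TYPE('a) p n m"
      unfolding eq using F False by (intro SUP_upper) simp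
    then have "enn2real (ennreal (?L / ?S)) \<le> enn2real (C_const TYPE('a) p n m)"
      using C by (intro enn2real_mono) auto
    moreover have "0 \<le> ?L / ?S"
      using S by (intro divide_nonneg_pos Lnorm_nonneg fin)
    ultimately have "?L / ?S \<le> enn2real (C_const TYPE('a) p n m)"
      by (simp only: enn2real_ennreal)
    then show ?thesis using S by (simp add: divide_le_eq)
  qed
qed

text \<open>The duality principle for the two difference operators. The equation holds against every \<open>F\<close>, which
  identifies \<open>D\<^sub>s\<^sub>g\<^sub>n\<^sup>* h\<close> with \<open>D\<^sub>l\<^sub>o\<^sub>n\<^sub>g\<^sup>* g\<close> by summation by parts.\<close>

theorem fibre_bounded_solution:
  fixes B :: "'a::real_normed_vector set" and g :: "(nat \<Rightarrow> int) \<times> nat \<Rightarrow> 'a \<Rightarrow>\<^sub>L real"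
  assumes p: "1 \<le> p" and n: "1 \<le> n" and m: "1 \<le> m" and B: "finite B" "span B = UNIV"
    and C: "C_const TYPE('a) p n m < \<infinity>"
  obtains h where "h \<in> fibre m n g"
    "Lnorm (conj_exponent p) (G m n \<times> signs n) h
      \<le> enn2real (C_const TYPE('a) p n m) * Lnorm (conj_exponent p) (G m n \<times> {1..n}) g"
proof -
  have fin: "finite (G m n \<times> {1..n})" "G m n \<times> {1..n} \<noteq> {}"
    "finite (G m n \<times> signs n)" "G m n \<times> signs n \<noteq> {}"
    using n m by (simp_all add: finite_G finite_signs G_nonempty signs_nonempty)
  obtain h where h: "h \<in> maps (G m n \<times> signs n)"
    "\<And>F. F \<in> maps (G m n) \<Longrightarrow> pairing (G m n \<times> signs n) (D_sgn m n F) h = pairing (G m n \<times> {1..n}) (D_long m n F) g"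
    "Lnorm (conj_exponent p) (G m n \<times> signs n) h
      \<le> enn2real (C_const TYPE('a) p n m) * Lnorm (conj_exponent p) (G m n \<times> {1..n}) g"
  proof (rule adjoint_solution_exists[OF p fin B subspace_maps[of "G m n"], where ?D1.0 = "D_long m n" and ?D2.0 = "D_sgn m n"
        and g = g and K = "enn2real (C_const TYPE('a) p n m)"])
    show "D_sgn m n F \<in> maps (G m n \<times> signs n)" for F :: "(nat \<Rightarrow> int) \<Rightarrow> 'a"
      by (auto simp: D_sgn_def maps_def)
    show "Lnorm (ereal p) (G m n \<times> {1..n}) (D_long m n F)
        \<le> enn2real (C_const TYPE('a) p n m) * Lnorm (ereal p) (G m n \<times> signs n) (D_sgn m n F)"
      if "F \<in> maps (G m n)" for F :: "(nat \<Rightarrow> int) \<Rightarrow> 'a"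
      by (rule Lnorm_D_long_le[OF p n m C that])
  qed (rule D_long_linear D_sgn_linear enn2real_nonneg | blast)+
  have "D_sgn_adj m n h = D_long_adj m n g"
  proof (rule pairing_separates[OF finite_G])
    show "pairing (G m n) F (D_sgn_adj m n h) = pairing (G m n) F (D_long_adj m n g)"
      if "F \<in> maps (G m n)" for F
      using h(2)[OF that] unfolding pairing_D_sgn[OF m] pairing_D_long[OF m] .
  qed (auto simp: maps_def D_sgn_adj_def D_long_adj_def)
  then show ?thesis using h by (intro that) (auto simp: fibre_def)
qed

section \<open>Selections of linear relations\<close>

text \<open>A set-valued map whose graph is a linear subspace. Such a relation contains every
  combination \<open>\<Sum>c\<^sub>i h\<^sub>i\<close> of given solutions over \<open>\<Sum>c\<^sub>i g\<^sub>i\<close>, which is what allows local selections to be glued.\<close>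

definition linear_relation :: "('g::real_vector \<Rightarrow> 'h::real_vector set) \<Rightarrow> bool" where
  "linear_relation H \<longleftrightarrow> 0 \<in> H 0
     \<and> (\<forall>g g'. \<forall>h\<in>H g. \<forall>h'\<in>H g'. h + h' \<in> H (g + g'))
     \<and> (\<forall>t g. \<forall>h\<in>H g. t *\<^sub>R h \<in> H (t *\<^sub>R g))"

lemma linear_relationD:
  assumes "linear_relation H"
  shows "0 \<in> H 0"
    and "h \<in> H g \<Longrightarrow> h' \<in> H g' \<Longrightarrow> h + h' \<in> H (g + g')"
    and "h \<in> H g \<Longrightarrow> t *\<^sub>R h \<in> H (t *\<^sub>R g)"
  using assms by (auto simp: linear_relation_def)

lemma linear_relation_sum:
  assumes H: "linear_relation H" and "finite A" "\<And>i. i \<in> A \<Longrightarrow> f i \<in> H (k i)"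
  shows "sum f A \<in> H (sum k A)"
  using assms(2,3)
proof (induction A rule: finite_induct)
  case empty
  show ?case unfolding sum.empty by (rule linear_relationD(1)[OF H])
next
  case (insert i A)
  then show ?case unfolding sum.insert[OF insert(1,2)] by (intro linear_relationD(2)[OF H]) auto
qed

text \<open>Compatibility with scaling constrains a choice only along each line through the origin, so it is enough to choose
  one vector \<open>rep g\<close> on every line and an element over it, and to transport that element by the
  scalar \<open>coef g\<close>. The scalar is unique away from the origin, which makes the choice homogeneous for
  all real factors.\<close>

lemma odd_homogeneous_choice:
  fixes P :: "'g::real_vector \<Rightarrow> 'h::real_vector set"
  assumes V: "subspace V" and ex: "\<And>g. g \<in> V \<Longrightarrow> P g \<noteq> {}" and zero: "0 \<in> P 0"
    and scale: "\<And>t g h. t \<noteq> 0 \<Longrightarrow> h \<in> P g \<Longrightarrow> t *\<^sub>R h \<in> P (t *\<^sub>R g)"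
  obtains \<Phi> where "\<And>g. g \<in> V \<Longrightarrow> \<Phi> g \<in> P g" "\<And>t g. \<Phi> (t *\<^sub>R g) = t *\<^sub>R \<Phi> g"
proof -
  define line where "line = (\<lambda>g::'g. {t *\<^sub>R g | t. t \<noteq> 0})"
  define rep where "rep = (\<lambda>g. SOME x. x \<in> line g)"
  define coef where "coef = (\<lambda>g. SOME s. s \<noteq> 0 \<and> g = s *\<^sub>R rep g)"
  define pick where "pick = (\<lambda>g. SOME h. h \<in> P g)"
  define \<Phi> where "\<Phi> = (\<lambda>g. if g = 0 then 0 else coef g *\<^sub>R pick (rep g))"
  have line_scale: "line (t *\<^sub>R g) = line g" if "t \<noteq> 0" for t g
  proof -
    have "s *\<^sub>R g \<in> line (t *\<^sub>R g)" if "s \<noteq> 0" for s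
      unfolding line_def using that \<open>t \<noteq> 0\<close> by (intro CollectI exI[of _ "s / t"]) simp
    moreover have "s *\<^sub>R t *\<^sub>R g \<in> line g" if "s \<noteq> 0" for s
      unfolding line_def using that \<open>t \<noteq> 0\<close> by (intro CollectI exI[of _ "s * t"]) simp
    ultimately show ?thesis by (auto simp: line_def)
  qed
  have rep: "\<exists>t. t \<noteq> 0 \<and> rep g = t *\<^sub>R g" for g
  proof -
    have "1 *\<^sub>R g \<in> line g" unfolding line_def by (intro CollectI exI[of _ 1]) simp
    then have "rep g \<in> line g" unfolding rep_def by (rule someI)
    then show ?thesis by (auto simp: line_def)
  qed
  have coef: "coef g \<noteq> 0 \<and> g = coef g *\<^sub>R rep g" for g
  proof -
    obtain t where t: "t \<noteq> 0" "rep g = t *\<^sub>R g" using rep by blast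
    have "1 / t \<noteq> 0 \<and> g = (1 / t) *\<^sub>R rep g" using t by simp
    then show ?thesis unfolding coef_def by (rule someI)
  qed
  have "\<Phi> g \<in> P g" if g: "g \<in> V" for g
  proof (cases "g = 0")
    case False
    obtain t where t: "rep g = t *\<^sub>R g" using rep by blast
    have "pick (rep g) \<in> P (rep g)"
      using ex[of "rep g"] subspace_scale[OF V g, of t] unfolding pick_def t by (simp add: some_in_eq)
    then have "coef g *\<^sub>R pick (rep g) \<in> P (coef g *\<^sub>R rep g)"
      using coef by (intro scale) auto
    then show ?thesis using coef[of g] False by (simp add: \<Phi>_def)
  qed (simp add: \<Phi>_def zero)
  moreover have "\<Phi> (t *\<^sub>R g) = t *\<^sub>R \<Phi> g" for t g
  proof (cases "t = 0 \<or> g = 0")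
    case False
    then have r: "rep (t *\<^sub>R g) = rep g" by (simp add: rep_def line_scale)
    have "rep g \<noteq> 0" using coef[of g] False by force
    moreover have "coef (t *\<^sub>R g) *\<^sub>R rep g = t *\<^sub>R coef g *\<^sub>R rep g"
      using coef[of g] coef[of "t *\<^sub>R g"] by (simp add: r)
    ultimately have "coef (t *\<^sub>R g) = t * coef g" by simp
    then show ?thesis using False by (simp add: \<Phi>_def r)
  qed (auto simp: \<Phi>_def)
  ultimately show ?thesis by (rule that)
qed

text \<open>The part of \<open>S\<close> that lies in the ball through one of its points is compact.\<close>

lemma closed_attains_min_Lnorm:
  fixes C :: "'b::real_normed_vector set" and S :: "('w \<Rightarrow> 'b) set"
  assumes r: "1 \<le> r" "finite \<Omega>" "\<Omega> \<noteq> {}" and C: "finite C" "span C = UNIV"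
    and S: "closed S" "S \<subseteq> maps \<Omega>" "S \<noteq> {}"
  shows "\<exists>h\<in>S. \<forall>k\<in>S. Lnorm r \<Omega> h \<le> Lnorm r \<Omega> k"
proof -
  obtain k0 where k0: "k0 \<in> S" using S by auto
  let ?T = "(maps \<Omega> \<inter> {F. Lnorm r \<Omega> F \<le> Lnorm r \<Omega> k0}) \<inter> S"
  have "compact ?T" by (intro compact_Int_closed compact_Lnorm_ball[OF r C] S)
  moreover have "?T \<noteq> {}" using k0 S by auto
  ultimately obtain h where h: "h \<in> ?T" "\<And>k. k \<in> ?T \<Longrightarrow> Lnorm r \<Omega> h \<le> Lnorm r \<Omega> k"
    using continuous_attains_inf[OF _ _ continuous_on_Lnorm[OF r]] by metis
  have "Lnorm r \<Omega> h \<le> Lnorm r \<Omega> k" if "k \<in> S" for k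
  proof (cases "Lnorm r \<Omega> k \<le> Lnorm r \<Omega> k0")
    case True
    then show ?thesis using h(2)[of k] that S by auto
  next
    case False
    then show ?thesis using h(2)[of k0] k0 S by auto
  qed
  then show ?thesis using h by blast
qed

text \<open>Choose an element over each of the finitely many maps \<open>point_map w b\<close> and extend linearly in the
  coordinates. The constant \<open>M\<close> is not controlled by the given norm bound; the lift is used only to correct small differences.\<close>

lemma linear_continuous_lift:
  fixes H :: "('v \<Rightarrow> 'b::real_normed_vector) \<Rightarrow> ('w \<Rightarrow> 'c::real_normed_vector) set" and C :: "'b set"
  assumes r: "1 \<le> r" and \<Omega>: "finite \<Omega>" "\<Omega> \<noteq> {}" and \<Omega>': "finite \<Omega>'" "\<Omega>' \<noteq> {}"
    and C: "finite C" "span C = UNIV"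
    and H: "linear_relation H" and ex: "\<And>g. g \<in> maps \<Omega> \<Longrightarrow> H g \<noteq> {}"
  obtains L M where "\<And>g. g \<in> maps \<Omega> \<Longrightarrow> L g \<in> H g" "\<And>t g. L (t *\<^sub>R g) = t *\<^sub>R L g"
    "\<And>v. continuous_on UNIV (\<lambda>g. L g v)"
    "0 < M" "\<And>g. Lnorm r \<Omega>' (L g) \<le> M * Lnorm r \<Omega> g"
proof -
  obtain I and c :: "'b \<Rightarrow> 'b \<Rightarrow> real" where I: "finite I" "\<And>b. bounded_linear (c b)"
    "\<And>x. (\<Sum>b\<in>I. c b x *\<^sub>R b) = x" using finite_dim_coordinates[OF C] by blast
  have "\<exists>h. h \<in> H (point_map w b)" if "w \<in> \<Omega>" for w b
    using ex[OF point_map_in_maps[OF that]] by blast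
  then obtain h where h: "\<And>w b. w \<in> \<Omega> \<Longrightarrow> h w b \<in> H (point_map w b)" by metis
  define L where "L = (\<lambda>g :: 'v \<Rightarrow> 'b. \<Sum>(w, b)\<in>\<Omega> \<times> I. c b (g w) *\<^sub>R h w b)"
  have fin: "finite (\<Omega> \<times> I)" using \<Omega> I by simp
  have lift: "L g \<in> H g" if g: "g \<in> maps \<Omega>" for g
  proof -
    have "L g \<in> H (\<Sum>(w, b)\<in>\<Omega> \<times> I. c b (g w) *\<^sub>R point_map w b)"
      unfolding L_def by (intro linear_relation_sum[OF H fin]) (auto intro!: linear_relationD(3)[OF H] h)
    also have "(\<Sum>(w, b)\<in>\<Omega> \<times> I. c b (g w) *\<^sub>R point_map w b) = (\<Sum>w\<in>\<Omega>. point_map w (g w))"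
    proof
      fix v
      have "(\<Sum>b\<in>I. c b (g w) *\<^sub>R point_map w b v) = point_map w (g w) v" for w
        by (cases "v = w") (simp_all add: I(3))
      moreover have "(\<Sum>(w, b)\<in>\<Omega> \<times> I. c b (g w) *\<^sub>R point_map w b) v
          = (\<Sum>w\<in>\<Omega>. \<Sum>b\<in>I. c b (g w) *\<^sub>R point_map w b v)"
        by (simp add: sum_fun_apply case_prod_unfold sum.cartesian_product)
      ultimately show "(\<Sum>(w, b)\<in>\<Omega> \<times> I. c b (g w) *\<^sub>R point_map w b) v = (\<Sum>w\<in>\<Omega>. point_map w (g w)) v"
        by (simp add: sum_fun_apply)
    qed
    also have "\<dots> = g" by (rule maps_eq_sum_point_map[OF \<Omega>(1) g, symmetric])
    finally show ?thesis .
  qed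
  have hom: "L (t *\<^sub>R g) = t *\<^sub>R L g" for t g
    by (auto simp: L_def fun_eq_iff sum_fun_apply scaleR_sum_right case_prod_unfold
        linear_simps(5)[OF I(2)] intro!: sum.cong)
  have cont: "continuous_on UNIV (\<lambda>g. L g v)" for v
    unfolding L_def sum_fun_apply case_prod_unfold scaleR_fun_apply
    by (intro continuous_intros bounded_linear.continuous_on[OF I(2)] continuous_on_product_coordinates)
  have "\<exists>M>0. \<forall>g. Lnorm r \<Omega>' (L g) \<le> M * Lnorm r \<Omega> g"
  proof (intro exI conjI allI)
    define M where "M = (\<Sum>(w, b)\<in>\<Omega> \<times> I. onorm (c b) * real (card \<Omega>) * Lnorm r \<Omega>' (h w b))"
    have M: "0 \<le> M"
      unfolding M_def by (intro sum_nonneg) (auto intro!: mult_nonneg_nonneg onorm_pos_le I(2) Lnorm_nonneg \<Omega>')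
    show "0 < M + 1" using M by simp
    fix g :: "'v \<Rightarrow> 'b"
    have "Lnorm r \<Omega>' (L g) \<le> (\<Sum>x\<in>\<Omega> \<times> I. Lnorm r \<Omega>' (case x of (w, b) \<Rightarrow> c b (g w) *\<^sub>R h w b))"
      unfolding L_def by (rule Lnorm_sum_le[OF r \<Omega>'])
    also have "\<dots> \<le> (\<Sum>x\<in>\<Omega> \<times> I. (case x of (w, b) \<Rightarrow> onorm (c b) * real (card \<Omega>) * Lnorm r \<Omega>' (h w b)) * Lnorm r \<Omega> g)"
    proof (intro sum_mono)
      fix x assume "x \<in> \<Omega> \<times> I"
      then obtain w b where x: "x = (w, b)" "w \<in> \<Omega>" by auto
      have "\<bar>c b (g w)\<bar> \<le> onorm (c b) * norm (g w)" using onorm[OF I(2), of b "g w"] by simp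
      also have "\<dots> \<le> onorm (c b) * (real (card \<Omega>) * Lnorm r \<Omega> g)"
        by (intro mult_left_mono norm_le_Lnorm r \<Omega> x onorm_pos_le I(2))
      finally have "\<bar>c b (g w)\<bar> * Lnorm r \<Omega>' (h w b)
          \<le> onorm (c b) * (real (card \<Omega>) * Lnorm r \<Omega> g) * Lnorm r \<Omega>' (h w b)"
        by (intro mult_right_mono Lnorm_nonneg \<Omega>')
      then show "Lnorm r \<Omega>' (case x of (w, b) \<Rightarrow> c b (g w) *\<^sub>R h w b)
          \<le> (case x of (w, b) \<Rightarrow> onorm (c b) * real (card \<Omega>) * Lnorm r \<Omega>' (h w b)) * Lnorm r \<Omega> g"
        by (simp add: x Lnorm_scaleR[OF r \<Omega>'] mult_ac)
    qed
    also have "\<dots> = M * Lnorm r \<Omega> g" by (simp only: M_def sum_distrib_right)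
    also have "\<dots> \<le> (M + 1) * Lnorm r \<Omega> g" by (intro mult_right_mono Lnorm_nonneg \<Omega>) simp
    finally show "Lnorm r \<Omega>' (L g) \<le> (M + 1) * Lnorm r \<Omega> g" .
  qed
  then obtain M where M: "0 < M" "\<And>g. Lnorm r \<Omega>' (L g) \<le> M * Lnorm r \<Omega> g" by blast
  show ?thesis
    by (rule that[of L M]) (erule lift, rule hom, rule cont, rule M(1), rule M(2))
qed

lemma finite_net_of_sphere:
  fixes C :: "'b::real_normed_vector set"
  assumes r: "1 \<le> r" "finite \<Omega>" "\<Omega> \<noteq> {}" and C: "finite C" "span C = UNIV" and d: "0 < d"
  obtains T where "finite T" "T \<subseteq> maps \<Omega>" "\<And>x. x \<in> T \<Longrightarrow> Lnorm r \<Omega> x = 1"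
    "\<And>g :: 'w \<Rightarrow> 'b. g \<in> maps \<Omega> \<Longrightarrow> Lnorm r \<Omega> g = 1 \<Longrightarrow> \<exists>x\<in>T. Lnorm r \<Omega> (g - x) < d"
proof -
  let ?S = "(maps \<Omega> \<inter> {F :: 'w \<Rightarrow> 'b. Lnorm r \<Omega> F \<le> 1}) \<inter> {F. Lnorm r \<Omega> F = 1}"
  have S: "compact ?S"
    by (intro compact_Int_closed compact_Lnorm_ball[OF r C] closed_level_set continuous_on_Lnorm r)
  have op: "open {g. Lnorm r \<Omega> (g - x) < d}" for x :: "'w \<Rightarrow> 'b"
  proof -
    have "continuous_on UNIV (\<lambda>g. (g - x) w)" for w
      unfolding minus_apply by (intro continuous_intros continuous_on_product_coordinates)
    then show ?thesis
      by (intro open_Collect_less continuous_on_Lnorm_comp[OF r] continuous_on_const)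
  qed
  have cover: "?S \<subseteq> (\<Union>x\<in>?S. {g. Lnorm r \<Omega> (g - x) < d})"
  proof
    fix g assume "g \<in> ?S"
    moreover have "Lnorm r \<Omega> (g - g) = 0" by (simp add: Lnorm_eq_0_iff[OF r])
    then have "Lnorm r \<Omega> (g - g) < d" using d by simp
    ultimately show "g \<in> (\<Union>x\<in>?S. {g. Lnorm r \<Omega> (g - x) < d})" by blast
  qed
  obtain T where "T \<subseteq> ?S" "finite T" "?S \<subseteq> (\<Union>x\<in>T. {g. Lnorm r \<Omega> (g - x) < d})"
    by (rule compactE_image[OF S op cover])
  then show ?thesis by (intro that[of T]) auto
qed

text \<open>Near a point \<open>x\<close> of the unit sphere, \<open>k x + L (g - x)\<close> is a continuous selection whose norm exceeds that of the good element
  \<open>k x\<close> only by \<open>M\<close> times the distance from \<open>g\<close> to \<open>x\<close>. A partition of unity over a finite net of the sphere glues these local selections, since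
  the values of a linear relation are affine subspaces. Every ingredient is written for all \<open>g\<close> at once by
  replacing \<open>x\<close> with its multiple of the norm of \<open>g\<close>, so that homogeneity is built in and division by the norm is avoided.\<close>

lemma continuous_homogeneous_selection:
  fixes H :: "('v \<Rightarrow> 'b::real_normed_vector) \<Rightarrow> ('w \<Rightarrow> 'c::real_normed_vector) set" and C :: "'b set"
  assumes r: "1 \<le> r" and \<Omega>: "finite \<Omega>" "\<Omega> \<noteq> {}" and \<Omega>': "finite \<Omega>'" "\<Omega>' \<noteq> {}"
    and C: "finite C" "span C = UNIV"
    and H: "linear_relation H" "\<And>g. H g \<subseteq> maps \<Omega>'"
    and K: "0 < K" "\<And>g. g \<in> maps \<Omega> \<Longrightarrow> \<exists>h\<in>H g. Lnorm r \<Omega>' h \<le> K * Lnorm r \<Omega> g"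
    and e: "0 < e"
  obtains \<Psi> where "\<And>g. g \<in> maps \<Omega> \<Longrightarrow> \<Psi> g \<in> H g"
    "\<And>t g. 0 \<le> t \<Longrightarrow> \<Psi> (t *\<^sub>R g) = t *\<^sub>R \<Psi> g"
    "continuous_on (maps \<Omega>) \<Psi>"
    "\<And>g. g \<in> maps \<Omega> \<Longrightarrow> Lnorm r \<Omega>' (\<Psi> g) \<le> (1 + e) * K * Lnorm r \<Omega> g"
proof -
  let ?N = "Lnorm r \<Omega>" and ?N' = "Lnorm r \<Omega>'"
  have N_nonneg: "0 \<le> ?N g" for g :: "'v \<Rightarrow> 'b" by (rule Lnorm_nonneg[OF \<Omega>])
  have ex: "H g \<noteq> {}" if "g \<in> maps \<Omega>" for g using K(2)[OF that] by blast
  obtain L M where L: "\<And>g. g \<in> maps \<Omega> \<Longrightarrow> L g \<in> H g" "\<And>t g. L (t *\<^sub>R g) = t *\<^sub>R L g"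
    and L_cont1: "\<And>v. continuous_on UNIV (\<lambda>g. L g v)"
    and M: "0 < M" "\<And>g. ?N' (L g) \<le> M * ?N g"
    using linear_continuous_lift[OF r \<Omega> \<Omega>' C H(1) ex] by blast
  have L_cont: "continuous_on S (\<lambda>x. L (f x) v)"
    if "\<And>w. continuous_on S (\<lambda>x. f x w)" for S v and f :: "('v \<Rightarrow> 'b) \<Rightarrow> 'v \<Rightarrow> 'b"
    by (rule continuous_on_compose2[OF L_cont1 continuous_on_coordinatewise_then_product[of S f]])
      (use that in auto)
  \<comment> \<open>The net is so fine that the correction by \<open>L\<close> costs at most \<open>e * K\<close> on the unit sphere.\<close>
  define d where "d = e * K / M"
  have d: "0 < d" "M * d = e * K" using e K(1) M(1) by (auto simp: d_def)
  obtain T where T: "finite T" "T \<subseteq> maps \<Omega>" "\<And>x. x \<in> T \<Longrightarrow> ?N x = 1"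
    "\<And>g :: 'v \<Rightarrow> 'b. g \<in> maps \<Omega> \<Longrightarrow> ?N g = 1 \<Longrightarrow> \<exists>x\<in>T. ?N (g - x) < d"
    using finite_net_of_sphere[OF r \<Omega> C d(1)] by blast
  have "\<exists>h\<in>H x. ?N' h \<le> K" if "x \<in> T" for x
    using K(2)[of x] T(2,3) that by fastforce
  then obtain k where k: "\<And>x. x \<in> T \<Longrightarrow> k x \<in> H x" "\<And>x. x \<in> T \<Longrightarrow> ?N' (k x) \<le> K" by metis
  \<comment> \<open>The weight of \<open>x\<close> is positive exactly where \<open>g\<close> is closer than \<open>d * ?N g\<close> to the multiple of \<open>x\<close> of the same norm.\<close>
  define w where "w = (\<lambda>(x :: 'v \<Rightarrow> 'b) g. max 0 (d * ?N g - ?N (g - ?N g *\<^sub>R x)))"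
  define W where "W = (\<lambda>g. \<Sum>x\<in>T. w x g)"
  define piece where "piece = (\<lambda>x g. ?N g *\<^sub>R k x + L (g - ?N g *\<^sub>R x))"
  \<comment> \<open>If \<open>?N g = 0\<close> then all weights vanish, and \<open>1 / 0 = 0\<close> gives \<open>\<Psi> g = 0\<close>.\<close>
  define \<Psi> where "\<Psi> = (\<lambda>g. (1 / W g) *\<^sub>R (\<Sum>x\<in>T. w x g *\<^sub>R piece x g))"
  have w_nonneg: "0 \<le> w x g" for x g by (simp add: w_def)
  have W_pos: "0 < W g" if g: "g \<in> maps \<Omega>" "?N g \<noteq> 0" for g
  proof -
    have N: "0 < ?N g" using N_nonneg[of g] g(2) by linarith
    have "?N ((1 / ?N g) *\<^sub>R g) = 1" using N by (simp add: Lnorm_scaleR[OF r \<Omega>])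
    then obtain x where x: "x \<in> T" "?N ((1 / ?N g) *\<^sub>R g - x) < d"
      using T(4)[OF subspace_scale[OF subspace_maps g(1)]] by blast
    have "g - ?N g *\<^sub>R x = ?N g *\<^sub>R ((1 / ?N g) *\<^sub>R g - x)"
      using N by (simp add: scaleR_diff_right)
    then have "?N (g - ?N g *\<^sub>R x) = ?N g * ?N ((1 / ?N g) *\<^sub>R g - x)"
      using N by (simp add: Lnorm_scaleR[OF r \<Omega>])
    also have "\<dots> < ?N g * d" using N x(2) by (intro mult_strict_left_mono)
    finally have "0 < w x g" by (simp add: w_def mult.commute)
    also have "w x g \<le> W g"
      unfolding W_def using x(1) T(1) w_nonneg by (intro member_le_sum) auto
    finally show ?thesis .
  qed
  have N_zero: "g = 0" if "g \<in> maps \<Omega>" "?N g = 0" for g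
    using that Lnorm_eq_0_iff[OF r \<Omega>, of g] by (force simp: maps_def fun_eq_iff)
  have \<Psi>_zero: "\<Psi> g = 0" if "?N g = 0" for g
  proof -
    have "w x g = 0" for x
      using that Lnorm_nonneg[OF \<Omega>, of r g] by (simp add: w_def)
    then show ?thesis by (simp add: \<Psi>_def W_def)
  qed
  have lifts: "\<Psi> g \<in> H g" if g: "g \<in> maps \<Omega>" for g
  proof (cases "?N g = 0")
    case True
    then show ?thesis using \<Psi>_zero N_zero[OF g] linear_relationD(1)[OF H(1)] by simp
  next
    case False
    have t: "piece x g \<in> H g" if "x \<in> T" for x
    proof -
      have Nx: "?N g *\<^sub>R x \<in> maps \<Omega>" using T(2) that by (intro subspace_scale[OF subspace_maps]) auto
      have "piece x g \<in> H (?N g *\<^sub>R x + (g - ?N g *\<^sub>R x))"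
        unfolding piece_def
        by (intro linear_relationD(2,3)[OF H(1)] k that L subspace_diff[OF subspace_maps] g Nx)
      then show ?thesis by simp
    qed
    have "\<Psi> g \<in> H ((1 / W g) *\<^sub>R (\<Sum>x\<in>T. w x g *\<^sub>R g))"
      unfolding \<Psi>_def by (intro linear_relationD(3)[OF H(1)] linear_relation_sum[OF H(1) T(1)] t)
    also have "(1 / W g) *\<^sub>R (\<Sum>x\<in>T. w x g *\<^sub>R g) = g"
    proof -
      have "(\<Sum>x\<in>T. w x g *\<^sub>R g) = W g *\<^sub>R g" unfolding W_def by (rule scaleR_sum_left[symmetric])
      then show ?thesis using W_pos[OF g False] by simp
    qed
    finally show ?thesis .
  qed
  have bound: "?N' (\<Psi> g) \<le> (1 + e) * K * ?N g" if g: "g \<in> maps \<Omega>" for g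
  proof (cases "?N g = 0")
    case True
    then show ?thesis using \<Psi>_zero[OF True] by (simp add: Lnorm_zero[OF r \<Omega>'])
  next
    case False
    have piece_le: "w x g * ?N' (piece x g) \<le> w x g * ((1 + e) * K * ?N g)" if x: "x \<in> T" for x
    proof (cases "w x g = 0")
      case False
      then have "?N (g - ?N g *\<^sub>R x) \<le> d * ?N g" by (simp add: w_def max_def split: if_splits)
      then have "M * ?N (g - ?N g *\<^sub>R x) \<le> M * (d * ?N g)" using M(1) by (intro mult_left_mono) auto
      then have "?N' (L (g - ?N g *\<^sub>R x)) \<le> e * K * ?N g"
        using M(2)[of "g - ?N g *\<^sub>R x"] by (simp add: d(2) flip: mult.assoc)
      moreover have "?N' (?N g *\<^sub>R k x) \<le> ?N g * K"
        using mult_left_mono[OF k(2)[OF x] N_nonneg[of g]] N_nonneg[of g] by (simp add: Lnorm_scaleR[OF r \<Omega>'])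
      ultimately have "?N' (piece x g) \<le> (1 + e) * K * ?N g"
        using Lnorm_add_le[OF r \<Omega>', of "?N g *\<^sub>R k x" "L (g - ?N g *\<^sub>R x)"]
        unfolding piece_def by (simp add: algebra_simps)
      then show ?thesis by (intro mult_left_mono w_nonneg)
    qed simp
    have "?N' (\<Psi> g) = (1 / W g) * ?N' (\<Sum>x\<in>T. w x g *\<^sub>R piece x g)"
      unfolding \<Psi>_def using W_pos[OF g False] by (simp add: Lnorm_scaleR[OF r \<Omega>'])
    also have "\<dots> \<le> (1 / W g) * (\<Sum>x\<in>T. ?N' (w x g *\<^sub>R piece x g))"
      using W_pos[OF g False] by (intro mult_left_mono Lnorm_sum_le[OF r \<Omega>']) auto
    also have "\<dots> \<le> (1 / W g) * (\<Sum>x\<in>T. w x g * ((1 + e) * K * ?N g))"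
      using W_pos[OF g False] piece_le
      by (intro mult_left_mono sum_mono) (simp_all add: Lnorm_scaleR[OF r \<Omega>'] w_nonneg)
    also have "\<dots> = (1 + e) * K * ?N g"
    proof -
      have "(\<Sum>x\<in>T. w x g * ((1 + e) * K * ?N g)) = W g * ((1 + e) * K * ?N g)"
        unfolding W_def by (rule sum_distrib_right[symmetric])
      then show ?thesis using W_pos[OF g False] by simp
    qed
    finally show ?thesis .
  qed
  have homogeneous: "\<Psi> (t *\<^sub>R g) = t *\<^sub>R \<Psi> g" if t: "0 \<le> t" for t g
  proof (cases "t = 0")
    case True
    have "?N (t *\<^sub>R g) = 0" using True unfolding Lnorm_scaleR[OF r \<Omega>] by simp
    then show ?thesis using True \<Psi>_zero by simp
  next
    case False
    then have t: "0 < t" using t by simp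
    have N: "?N (t *\<^sub>R g) = t * ?N g" using t by (simp add: Lnorm_scaleR[OF r \<Omega>])
    have diff: "t *\<^sub>R g - (t * ?N g) *\<^sub>R x = t *\<^sub>R (g - ?N g *\<^sub>R x)" for x
      by (simp add: scaleR_diff_right)
    have w: "w x (t *\<^sub>R g) = t * w x g" for x
    proof -
      have "?N (t *\<^sub>R (g - ?N g *\<^sub>R x)) = t * ?N (g - ?N g *\<^sub>R x)"
        using t by (simp only: Lnorm_scaleR[OF r \<Omega>] abs_of_pos)
      then show ?thesis
        unfolding w_def N diff using t by (simp add: max_mult_distrib_left right_diff_distrib mult_ac)
    qed
    have piece: "piece x (t *\<^sub>R g) = t *\<^sub>R piece x g" for x
      unfolding piece_def N diff L(2) by (simp add: scaleR_add_right)
    show ?thesis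
      unfolding \<Psi>_def W_def w piece using t
      by (simp add: scaleR_sum_right scaleR_left_commute flip: sum_distrib_left) 
  qed
  have N_cont: "continuous_on S ?N" for S by (rule continuous_on_Lnorm[OF r \<Omega>])
  have diff_cont: "continuous_on S (\<lambda>g. (g - ?N g *\<^sub>R x) v)" for S x v
    unfolding minus_apply scaleR_fun_apply
    by (intro continuous_intros N_cont continuous_on_eval)
  have piece_cont: "continuous_on S (\<lambda>g. piece x g v)" for S x v
  proof -
    have "continuous_on S (\<lambda>g. L (g - ?N g *\<^sub>R x) v)" by (rule L_cont) (rule diff_cont)
    then show ?thesis
      unfolding piece_def plus_fun_apply scaleR_fun_apply by (intro continuous_intros N_cont)
  qed
  have w_cont: "continuous_on S (w x)" for S x
    unfolding w_def by (intro continuous_intros N_cont continuous_on_Lnorm_comp[OF r \<Omega>] diff_cont)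
  have W_cont: "continuous_on S W" for S
    unfolding W_def by (intro continuous_intros w_cont)
  have U: "open {g. W g \<noteq> 0}"
    by (intro open_Collect_neq W_cont continuous_on_const)
  have \<Psi>_cont: "continuous_on {g. W g \<noteq> 0} (\<lambda>g. \<Psi> g v)" for v
    unfolding \<Psi>_def scaleR_fun_apply sum_fun_apply
    by (intro continuous_intros W_cont w_cont piece_cont) auto
  have "continuous_on (maps \<Omega>) (\<lambda>g. \<Psi> g v)" for v
    unfolding continuous_on_def
  proof
    fix a :: "'v \<Rightarrow> 'b" assume a: "a \<in> maps \<Omega>"
    show "((\<lambda>g. \<Psi> g v) \<longlongrightarrow> \<Psi> a v) (at a within maps \<Omega>)"
    proof (cases "?N a = 0")
      case False
      then have aU: "a \<in> {g. W g \<noteq> 0}" using W_pos[OF a] by simp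
      then have "((\<lambda>g. \<Psi> g v) \<longlongrightarrow> \<Psi> a v) (at a within {g. W g \<noteq> 0})"
        using \<Psi>_cont[of v] unfolding continuous_on_def by blast
      then have "((\<lambda>g. \<Psi> g v) \<longlongrightarrow> \<Psi> a v) (at a)" using at_within_open[OF aU U] by simp
      then show ?thesis by (rule tendsto_within_subset) simp
    next
      case True
      \<comment> \<open>The formula degenerates at the origin; continuity there follows from the norm bound.\<close>
      have le: "norm (\<Psi> g v) \<le> real (card \<Omega>') * ((1 + e) * K * ?N g)" if g: "g \<in> maps \<Omega>" for g
      proof (cases "v \<in> \<Omega>'")
        case True
        have "norm (\<Psi> g v) \<le> real (card \<Omega>') * ?N' (\<Psi> g)" by (rule norm_le_Lnorm[OF r \<Omega>'(1) True])
        also have "\<dots> \<le> real (card \<Omega>') * ((1 + e) * K * ?N g)" by (intro mult_left_mono bound g) simp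
        finally show ?thesis .
      next
        case False
        then have "\<Psi> g v = 0" using lifts[OF g] H(2)[of g] by (auto simp: maps_def)
        then show ?thesis using e K(1) N_nonneg[of g] by simp
      qed
      have "(?N \<longlongrightarrow> 0) (at a within maps \<Omega>)"
        using N_cont[of "maps \<Omega>"] a True by (auto simp: continuous_on_def)
      then have "((\<lambda>g. real (card \<Omega>') * ((1 + e) * K * ?N g)) \<longlongrightarrow> 0) (at a within maps \<Omega>)"
        by (intro tendsto_mult_right_zero)
      then have "((\<lambda>g. \<Psi> g v) \<longlongrightarrow> 0) (at a within maps \<Omega>)"
        by (rule Lim_null_comparison[rotated]) (use le in \<open>auto simp: eventually_at_topological\<close>)
      then show ?thesis using \<Psi>_zero[OF True] by simp
    qed
  qed
  then have "continuous_on (maps \<Omega>) \<Psi>" by (rule continuous_on_coordinatewise_then_product)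
  then show ?thesis using lifts homogeneous bound by (intro that)
qed

text \<open>Averaging \<open>\<Psi>(g)\<close> with \<open>- \<Psi>(- g)\<close> makes a selection odd and preserves all its other properties.\<close>

theorem continuous_odd_homogeneous_selection:
  fixes H :: "('v \<Rightarrow> 'b::real_normed_vector) \<Rightarrow> ('w \<Rightarrow> 'c::real_normed_vector) set" and C :: "'b set"
  assumes r: "1 \<le> r" and \<Omega>: "finite \<Omega>" "\<Omega> \<noteq> {}" and \<Omega>': "finite \<Omega>'" "\<Omega>' \<noteq> {}"
    and C: "finite C" "span C = UNIV"
    and H: "linear_relation H" "\<And>g. H g \<subseteq> maps \<Omega>'"
    and K: "0 \<le> K" "\<And>g. g \<in> maps \<Omega> \<Longrightarrow> \<exists>h\<in>H g. Lnorm r \<Omega>' h \<le> K * Lnorm r \<Omega> g"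
    and e: "0 < e"
  obtains \<Phi> where "\<And>g. g \<in> maps \<Omega> \<Longrightarrow> \<Phi> g \<in> H g"
    "\<And>g. \<Phi> (- g) = - \<Phi> g" "\<And>t g. 0 \<le> t \<Longrightarrow> \<Phi> (t *\<^sub>R g) = t *\<^sub>R \<Phi> g"
    "continuous_on (maps \<Omega>) \<Phi>"
    "\<And>g. g \<in> maps \<Omega> \<Longrightarrow> Lnorm r \<Omega>' (\<Phi> g) \<le> (1 + e) * K * Lnorm r \<Omega> g"
proof (cases "K = 0")
  case True
  \<comment> \<open>With \<open>K = 0\<close> there is no slack for a correction, but the elements provided by the bound are then all \<open>0\<close>.\<close>
  have "0 \<in> H g" if g: "g \<in> maps \<Omega>" for g
  proof -
    obtain h where h: "h \<in> H g" "Lnorm r \<Omega>' h \<le> 0" using K(2)[OF g] True by auto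
    then have "Lnorm r \<Omega>' h = 0" using Lnorm_nonneg[OF \<Omega>', of r h] by simp
    then have "h = 0"
      using h(1) H(2)[of g] Lnorm_eq_0_iff[OF r \<Omega>', of h] by (force simp: maps_def fun_eq_iff)
    then show ?thesis using h(1) by simp
  qed
  moreover have "Lnorm r \<Omega>' (0 :: 'w \<Rightarrow> 'c) = 0" by (rule Lnorm_zero[OF r \<Omega>'])
  ultimately show ?thesis using True by (intro that[of "\<lambda>_. 0"]) auto
next
  case False
  then have Kpos: "0 < K" using K(1) by simp
  obtain \<Psi> where \<Psi>: "\<And>g. g \<in> maps \<Omega> \<Longrightarrow> \<Psi> g \<in> H g"
    "\<And>t g. 0 \<le> t \<Longrightarrow> \<Psi> (t *\<^sub>R g) = t *\<^sub>R \<Psi> g"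
    "continuous_on (maps \<Omega>) \<Psi>"
    "\<And>g. g \<in> maps \<Omega> \<Longrightarrow> Lnorm r \<Omega>' (\<Psi> g) \<le> (1 + e) * K * Lnorm r \<Omega> g"
    using continuous_homogeneous_selection[OF r \<Omega> \<Omega>' C H Kpos K(2) e] by blast
  define \<Phi> where "\<Phi> = (\<lambda>g. (1 / 2) *\<^sub>R (\<Psi> g + (- 1) *\<^sub>R \<Psi> (- g)))"
  have neg: "- g \<in> maps \<Omega>" if "g \<in> maps \<Omega>" for g :: "'v \<Rightarrow> 'b"
    using that by (rule subspace_neg[OF subspace_maps])
  show ?thesis
  proof (rule that[of \<Phi>])
    show "\<Phi> g \<in> H g" if g: "g \<in> maps \<Omega>" for g
    proof -
      have "\<Phi> g \<in> H ((1 / 2) *\<^sub>R (g + (- 1) *\<^sub>R (- g)))"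
        unfolding \<Phi>_def by (intro linear_relationD(2,3)[OF H(1)] \<Psi>(1) neg g)
      also have "(1 / 2) *\<^sub>R (g + (- 1) *\<^sub>R (- g)) = g" by (simp add: scaleR_2[symmetric])
      finally show ?thesis .
    qed
    show "\<Phi> (- g) = - \<Phi> g" for g
      by (simp add: \<Phi>_def flip: scaleR_minus_right)
    show "\<Phi> (t *\<^sub>R g) = t *\<^sub>R \<Phi> g" if "0 \<le> t" for t g
    proof -
      have "\<Psi> (- (t *\<^sub>R g)) = t *\<^sub>R \<Psi> (- g)" using \<Psi>(2)[OF that, of "- g"] by simp
      then show ?thesis using \<Psi>(2)[OF that, of g]
        by (simp add: \<Phi>_def scaleR_diff_right mult.commute)
    qed
    have "continuous_on (maps \<Omega>) (uminus :: ('v \<Rightarrow> 'b) \<Rightarrow> _)"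
      by (rule continuous_on_coordinatewise_then_product)
        (auto intro!: continuous_intros continuous_on_eval)
    then have "continuous_on (maps \<Omega>) (\<lambda>g. \<Psi> (- g))"
      by (rule continuous_on_compose2[OF \<Psi>(3)]) (use neg in auto)
    note cont = continuous_on_product_then_coordinatewise[OF this]
      continuous_on_product_then_coordinatewise[OF \<Psi>(3)]
    show "continuous_on (maps \<Omega>) \<Phi>"
      unfolding \<Phi>_def
      by (rule continuous_on_coordinatewise_then_product)
        (simp only: scaleR_fun_apply plus_fun_apply, intro continuous_intros cont)
    show "Lnorm r \<Omega>' (\<Phi> g) \<le> (1 + e) * K * Lnorm r \<Omega> g" if g: "g \<in> maps \<Omega>" for g
    proof -
      have "Lnorm r \<Omega>' (\<Phi> g) = (1 / 2) * Lnorm r \<Omega>' (\<Psi> g + (- 1) *\<^sub>R \<Psi> (- g))"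
        unfolding \<Phi>_def Lnorm_scaleR[OF r \<Omega>'] by simp
      moreover have "Lnorm r \<Omega>' (\<Psi> g + (- 1) *\<^sub>R \<Psi> (- g))
          \<le> Lnorm r \<Omega>' (\<Psi> g) + Lnorm r \<Omega>' ((- 1) *\<^sub>R \<Psi> (- g))"
        by (rule Lnorm_add_le[OF r \<Omega>'])
      moreover have "Lnorm r \<Omega>' ((- 1) *\<^sub>R \<Psi> (- g)) = Lnorm r \<Omega>' (\<Psi> (- g))"
        unfolding Lnorm_scaleR[OF r \<Omega>'] by simp
      moreover have "Lnorm r \<Omega>' (\<Psi> (- g)) \<le> (1 + e) * K * Lnorm r \<Omega> g"
        using \<Psi>(4)[OF neg[OF g]] unfolding Lnorm_minus[OF r \<Omega>] .
      ultimately show ?thesis using \<Psi>(4)[OF g] by linarith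
    qed
  qed
qed

section \<open>Selections of the solution fibres\<close>

lemma odd_on_if_minus: "(\<And>g. g \<in> L \<Longrightarrow> \<Phi> (- g) = - \<Phi> g) \<Longrightarrow> odd_on L \<Phi>"
  by (simp add: odd_on_def fun_Compl_def)

lemma pos_homogeneous_on_if_scaleR:
  "(\<And>t g. g \<in> L \<Longrightarrow> 0 \<le> t \<Longrightarrow> \<Phi> (t *\<^sub>R g) = t *\<^sub>R \<Phi> g) \<Longrightarrow> pos_homogeneous_on L \<Phi>"
  by (simp add: pos_homogeneous_on_def scaleR_fun_def)

lemma linear_relation_fibre: "linear_relation (fibre m n)"
  by (auto simp: linear_relation_def fibre_zero fibre_add fibre_scaleR)

theorem proposition1p6:
  fixes p :: real and n m :: nat and B :: "'a::banach set"
  assumes p: "1 \<le> p" and n: "1 \<le> n" and m: "1 \<le> m"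
    and fin_dim: "finite B" "span B = UNIV"
    and C_finite: "C_const TYPE('a) p n m < \<infinity>"
  shows
    "(\<exists>\<Phi> :: ((nat \<Rightarrow> int) \<times> nat \<Rightarrow> ('a \<Rightarrow>\<^sub>L real)) \<Rightarrow> ((nat \<Rightarrow> int) \<times> (nat \<Rightarrow> int) \<Rightarrow> ('a \<Rightarrow>\<^sub>L real)).
        selection m n \<Phi> \<and> odd_on (maps (G m n \<times> {1..n})) \<Phi>
        \<and> pos_homogeneous_on (maps (G m n \<times> {1..n})) \<Phi>
        \<and> (\<forall>g \<in> maps (G m n \<times> {1..n}). \<forall>h \<in> fibre m n g.
              Lnorm (conj_exponent p) (G m n \<times> signs n) (\<Phi> g)
                \<le> Lnorm (conj_exponent p) (G m n \<times> signs n) h))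
     \<and> (\<forall>\<epsilon>>0. \<exists>\<Phi> :: ((nat \<Rightarrow> int) \<times> nat \<Rightarrow> ('a \<Rightarrow>\<^sub>L real)) \<Rightarrow> ((nat \<Rightarrow> int) \<times> (nat \<Rightarrow> int) \<Rightarrow> ('a \<Rightarrow>\<^sub>L real)).
        selection m n \<Phi> \<and> odd_on (maps (G m n \<times> {1..n})) \<Phi>
        \<and> pos_homogeneous_on (maps (G m n \<times> {1..n})) \<Phi>
        \<and> continuous_map (Ltopology (conj_exponent p) (G m n \<times> {1..n}))
                          (Ltopology (conj_exponent p) (G m n \<times> signs n)) \<Phi>
        \<and> (\<forall>g \<in> maps (G m n \<times> {1..n}).
              Lnorm (conj_exponent p) (G m n \<times> signs n) (\<Phi> g)
                \<le> (1 + \<epsilon>) * enn2real (C_const TYPE('a) p n m)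
                   * Lnorm (conj_exponent p) (G m n \<times> {1..n}) g))"
proof -
  let ?M = "maps (G m n \<times> {1..n}) :: ((nat \<Rightarrow> int) \<times> nat \<Rightarrow> ('a \<Rightarrow>\<^sub>L real)) set"
  let ?H = "fibre m n :: ((nat \<Rightarrow> int) \<times> nat \<Rightarrow> ('a \<Rightarrow>\<^sub>L real)) \<Rightarrow> ((nat \<Rightarrow> int) \<times> (nat \<Rightarrow> int) \<Rightarrow> ('a \<Rightarrow>\<^sub>L real)) set"
  let ?N = "Lnorm (conj_exponent p) (G m n \<times> {1..n})"
  let ?N' = "Lnorm (conj_exponent p) (G m n \<times> signs n)"
  let ?K = "enn2real (C_const TYPE('a) p n m)"
  have r: "1 \<le> conj_exponent p" by (rule conj_exponent_ge_1[OF p])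
  have long: "finite (G m n \<times> {1..n})" "G m n \<times> {1..n} \<noteq> {}"
    and sgn: "finite (G m n \<times> signs n)" "G m n \<times> signs n \<noteq> {}"
    using n m by (simp_all add: finite_G finite_signs G_nonempty signs_nonempty)
  obtain D :: "('a \<Rightarrow>\<^sub>L real) set" where D: "finite D" "span D = UNIV"
    by (rule dual_finite_dim[OF fin_dim])
  have fibre_maps: "?H g \<subseteq> maps (G m n \<times> signs n)" for g by (auto simp: fibre_def)
  have bounded: "\<exists>h\<in>?H g. ?N' h \<le> ?K * ?N g" for g
    by (rule fibre_bounded_solution[OF p n m fin_dim C_finite, of g]) blast
  have selection1: "\<exists>\<Phi>. selection m n \<Phi> \<and> odd_on ?M \<Phi> \<and> pos_homogeneous_on ?M \<Phi>
      \<and> (\<forall>g\<in>?M. \<forall>h\<in>?H g. ?N' (\<Phi> g) \<le> ?N' h)"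
  proof -
    \<comment> \<open>Scaling by \<open>t \<noteq> 0\<close> maps the fibre of \<open>g\<close> onto that of \<open>t g\<close> and multiplies norms by \<open>\<bar>t\<bar>\<close>, so it preserves minimality.\<close>
    define P where "P = (\<lambda>g. {h \<in> ?H g. \<forall>k\<in>?H g. ?N' h \<le> ?N' k})"
    obtain \<Phi> where \<Phi>: "\<And>g. g \<in> ?M \<Longrightarrow> \<Phi> g \<in> P g" "\<And>t g. \<Phi> (t *\<^sub>R g) = t *\<^sub>R \<Phi> g"
    proof (rule odd_homogeneous_choice[of ?M P])
      show "subspace ?M" by (rule subspace_maps)
      show "P g \<noteq> {}" for g
        using closed_attains_min_Lnorm[OF r sgn D closed_fibre fibre_maps, of g] bounded[of g]
        by (auto simp: P_def)
      show "0 \<in> P 0"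
        using fibre_zero Lnorm_nonneg[OF sgn] by (auto simp: P_def Lnorm_zero[OF r sgn])
      show "t *\<^sub>R h \<in> P (t *\<^sub>R g)" if t: "t \<noteq> 0" and h: "h \<in> P g" for t g h
      proof -
        have "?N' (t *\<^sub>R h) \<le> ?N' k" if k: "k \<in> ?H (t *\<^sub>R g)" for k
        proof -
          have "(1 / t) *\<^sub>R k \<in> ?H ((1 / t) *\<^sub>R t *\<^sub>R g)" by (rule fibre_scaleR[OF k])
          then have "?N' h \<le> ?N' ((1 / t) *\<^sub>R k)" using h t by (simp add: P_def)
          then have "\<bar>t\<bar> * ?N' h \<le> \<bar>t\<bar> * ?N' ((1 / t) *\<^sub>R k)" by (intro mult_left_mono) auto
          then show ?thesis using t unfolding Lnorm_scaleR[OF r sgn] by simp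
        qed
        then show ?thesis using h by (simp add: P_def fibre_scaleR)
      qed
    qed blast
    have "odd_on ?M \<Phi>" using \<Phi>(2)[of "- 1"] by (intro odd_on_if_minus) simp
    moreover have "pos_homogeneous_on ?M \<Phi>" by (intro pos_homogeneous_on_if_scaleR \<Phi>(2))
    ultimately show ?thesis
      using \<Phi>(1) by (intro exI[of _ \<Phi>]) (auto simp: selection_def P_def)
  qed
  have selection2: "\<exists>\<Phi>. selection m n \<Phi> \<and> odd_on ?M \<Phi> \<and> pos_homogeneous_on ?M \<Phi>
      \<and> continuous_map (Ltopology (conj_exponent p) (G m n \<times> {1..n}))
          (Ltopology (conj_exponent p) (G m n \<times> signs n)) \<Phi>
      \<and> (\<forall>g\<in>?M. ?N' (\<Phi> g) \<le> (1 + \<epsilon>) * ?K * ?N g)" if \<epsilon>: "0 < \<epsilon>" for \<epsilon>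
  proof -
    obtain \<Phi> where \<Phi>: "\<And>g. g \<in> ?M \<Longrightarrow> \<Phi> g \<in> ?H g"
      "\<And>g. \<Phi> (- g) = - \<Phi> g" "\<And>t g. 0 \<le> t \<Longrightarrow> \<Phi> (t *\<^sub>R g) = t *\<^sub>R \<Phi> g"
      "continuous_on ?M \<Phi>" "\<And>g. g \<in> ?M \<Longrightarrow> ?N' (\<Phi> g) \<le> (1 + \<epsilon>) * ?K * ?N g"
      using continuous_odd_homogeneous_selection[OF r long sgn D linear_relation_fibre fibre_maps
          enn2real_nonneg bounded \<epsilon>] by blast
    have "continuous_map (Ltopology (conj_exponent p) (G m n \<times> {1..n}))
        (Ltopology (conj_exponent p) (G m n \<times> signs n)) \<Phi>"
      unfolding Ltopology_eq_product[OF r long] Ltopology_eq_product[OF r sgn] using \<Phi>(1,4) fibre_maps by (auto simp: continuous_map_in_subtopology)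
    then show ?thesis
      using \<Phi> by (intro exI[of _ \<Phi>] conjI odd_on_if_minus pos_homogeneous_on_if_scaleR)
        (auto simp: selection_def)
  qed
  show ?thesis using selection1 selection2 by blast
qed

end
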